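(* Let $(F^4,g)$ and the orthonormal frame $\{e_1,e_2,e_3,e_4\}$ be as described in the context, with global coordinates $(x,y,s,t)$, $t>0$. Let $X=X_1(s,t)e_1+X_2(s,t)e_2+X_3(s,t)e_3+X_4(s,t)e_4$ be a smooth vector field on $F^4$ whose components depend only on $s$ and $t$. Then $X$ is a harmonic section with respect to $g$ if and only if $$\begin{aligned} 4t^2X_{1;tt}+4t^2X_{1;ss}+4tX_{2;s}-3X_1&=0,\\ 4t^2X_{2;tt}+4t^2X_{2;ss}-4tX_{1;s}-3X_2&=0,\\ 2t^2X_{3;tt}+2t^2X_{3;ss}-4tX_{4;s}-3X_3&=0,\\ 2t^2X_{4;tt}+2t^2X_{4;ss}+4tX_{3;s}-3X_4&=0, \end{aligned}$$ where $X_{j;s}=\frac{\partial X_j}{\partial s}$, $X_{j;ss}=\frac{\partial^2 X_j}{\partial s^2}$ and $X_{j;tt}=\frac{\partial^2 X_j}{\partial t^2}$.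
   Context: $F^4=\mathbb{R}^2\times\mathbb{H}^2$ with global coordinates $(x,y,s,t)$, where $(x,y)\in\mathbb{R}^2$ and $(s,t)$, $t>0$, are upper half-plane coordinates on $\mathbb{H}^2$. The frame $$e_1=\sqrt t\,\partial_x,\quad e_2=\tfrac{s}{\sqrt t}\partial_x+\tfrac{1}{\sqrt t}\partial_y,\quad e_3=2t\,\partial_s,\quad e_4=2t\,\partial_t$$ is declared orthonormal, which defines the Riemannian metric $g$; $\nabla$ denotes its Levi-Civita connection. A smooth vector field $X$ is a harmonic section if it is a critical point of the vertical energy $E_v(X;D)=\frac12\int_D|\nabla X|^2 v^g$ ($D$ compact domain), equivalently if it satisfies the Euler-Lagrange equation $$\overline{\Delta}X=\mathrm{Tr}_g\nabla^2X=\sum_{i=1}^4\big[\nabla_{e_i}\nabla_{e_i}X-\nabla_{\nabla_{e_i}e_i}X\big]=0.$$ *)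

theory Defs
  imports "HOL-Analysis.Analysis"
begin

section \<open>Smooth maps\<close>

fun Ck_on :: "nat \<Rightarrow> 'a::real_normed_vector set \<Rightarrow> ('a \<Rightarrow> 'b::real_normed_vector) \<Rightarrow> bool" where
  "Ck_on 0 S f \<longleftrightarrow> continuous_on S f"
| "Ck_on (Suc k) S f \<longleftrightarrow>
     (\<forall>p\<in>S. f differentiable (at p)) \<and> (\<forall>v. Ck_on k S (\<lambda>p. frechet_derivative f (at p) v))"

text \<open>Intended for open \<^term>\<open>S\<close> only: the derivatives are taken with respect to the whole space.\<close>

definition smooth_on :: "'a::real_normed_vector set \<Rightarrow> ('a \<Rightarrow> 'b::real_normed_vector) \<Rightarrow> bool" where
  "smooth_on S f \<longleftrightarrow> (\<forall>k. Ck_on k S f)"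

section \<open>The Levi-Civita connection in a coordinate chart\<close>

text \<open>Vector fields are given by their coordinate components, and \<^term>\<open>g p u v\<close> is the inner
  product of the tangent vectors \<^term>\<open>u\<close>, \<^term>\<open>v\<close> at \<^term>\<open>p\<close>.\<close>

type_synonym 'n metric_field = "real^'n \<Rightarrow> real^'n \<Rightarrow> real^'n \<Rightarrow> real"

definition coord :: "'n \<Rightarrow> real^'n" where
  "coord i = axis i 1"

definition gram :: "'n::finite metric_field \<Rightarrow> real^'n \<Rightarrow> real^'n^'n" where
  "gram g p = (\<chi> i j. g p (coord i) (coord j))"

text \<open>The derivative \<open>\<partial>\<^sub>k g\<^sub>i\<^sub>j\<close> at \<open>p\<close>:\<close>

definition dgram :: "'n::finite metric_field \<Rightarrow> real^'n \<Rightarrow> 'n \<Rightarrow> 'n \<Rightarrow> 'n \<Rightarrow> real" where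
  "dgram g p k i j = frechet_derivative (\<lambda>q. gram g q $ i $ j) (at p) (coord k)"

definition christoffel :: "'n::finite metric_field \<Rightarrow> real^'n \<Rightarrow> 'n \<Rightarrow> 'n \<Rightarrow> 'n \<Rightarrow> real" where
  "christoffel g p k i j =
     1/2 * (\<Sum>l\<in>UNIV. matrix_inv (gram g p) $ k $ l *
              (dgram g p i j l + dgram g p j i l - dgram g p l i j))"

text \<open>The usual coordinate formula; below it is shown to be torsion-free and compatible with the
  metric, which characterises the Levi-Civita connection.\<close>

definition levi_civita ::
  "'n::finite metric_field \<Rightarrow> (real^'n \<Rightarrow> real^'n) \<Rightarrow> (real^'n \<Rightarrow> real^'n) \<Rightarrow> real^'n \<Rightarrow> real^'n" where
  "levi_civita g X Y p = frechet_derivative Y (at p) (X p) +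
     (\<chi> k. \<Sum>i\<in>UNIV. \<Sum>j\<in>UNIV. christoffel g p k i j * X p $ i * Y p $ j)"

definition volume_density :: "'n::finite metric_field \<Rightarrow> real^'n \<Rightarrow> real" where
  "volume_density g p = sqrt (det (gram g p))"

section \<open>The manifold\<close>

text \<open>The global coordinates \<open>(x, y, s, t)\<close> of a point are its components 1, 2, 3, 4.\<close>

definition F4 :: "(real^4) set" where
  "F4 = {p. p $ 4 > 0}"

definition frame :: "4 \<Rightarrow> real^4 \<Rightarrow> real^4" where
  "frame i p = (let s = p $ 3; t = p $ 4 in
     if i = 1 then sqrt t *\<^sub>R coord 1
     else if i = 2 then (s / sqrt t) *\<^sub>R coord 1 + (1 / sqrt t) *\<^sub>R coord 2
     else if i = 3 then (2 * t) *\<^sub>R coord 3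
     else (2 * t) *\<^sub>R coord 4)"

text \<open>On \<^term>\<open>F4\<close> the frame is a basis, so the orthonormality condition determines a unique
  bilinear form; the values outside \<^term>\<open>F4\<close> are irrelevant.\<close>

definition metric_F4 :: "4 metric_field" where
  "metric_F4 p = (THE b. bilinear b \<and>
     (\<forall>i j. b (frame i p) (frame j p) = (if i = j then 1 else 0)))"

abbreviation nabla :: "(real^4 \<Rightarrow> real^4) \<Rightarrow> (real^4 \<Rightarrow> real^4) \<Rightarrow> real^4 \<Rightarrow> real^4" where
  "nabla \<equiv> levi_civita metric_F4"

section \<open>Vertical energy and harmonic sections\<close>

definition norm_nabla_sq :: "(real^4 \<Rightarrow> real^4) \<Rightarrow> real^4 \<Rightarrow> real" where
  "norm_nabla_sq X p =
     (\<Sum>i\<in>UNIV. metric_F4 p (nabla (frame i) X p) (nabla (frame i) X p))"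

definition vertical_energy :: "(real^4 \<Rightarrow> real^4) \<Rightarrow> (real^4) set \<Rightarrow> real" where
  "vertical_energy X D =
     1/2 * set_lebesgue_integral lborel D (\<lambda>p. norm_nabla_sq X p * volume_density metric_F4 p)"

text \<open>Critical points are taken among all smooth vector fields. These form a vector space, so a
  critical point is one at which the derivative in every direction \<open>V\<close> with compact support in
  \<open>D\<close> vanishes.\<close>

definition harmonic_section :: "(real^4 \<Rightarrow> real^4) \<Rightarrow> bool" where
  "harmonic_section X \<longleftrightarrow> smooth_on F4 X \<and>
     (\<forall>D V. compact D \<and> D \<subseteq> F4 \<and> smooth_on F4 V \<and> (\<forall>p\<in>F4 - D. V p = 0) \<longrightarrow>
        ((\<lambda>\<epsilon>. vertical_energy (\<lambda>p. X p + \<epsilon> *\<^sub>R V p) D) has_real_derivative 0) (at 0))"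

section \<open>Partial derivatives of functions of \<open>(s, t)\<close>\<close>

definition partial_s :: "(real \<Rightarrow> real \<Rightarrow> real) \<Rightarrow> real \<Rightarrow> real \<Rightarrow> real" where
  "partial_s f s t = deriv (\<lambda>u. f u t) s"

definition partial_t :: "(real \<Rightarrow> real \<Rightarrow> real) \<Rightarrow> real \<Rightarrow> real \<Rightarrow> real" where
  "partial_t f s t = deriv (\<lambda>u. f s u) t"

section \<open>The metric and its connection are the intended ones\<close>

definition metric_ex :: "4 metric_field" where
  "metric_ex p u v =
     (u$1 - p$3 * u$2) * (v$1 - p$3 * v$2) / p$4 + p$4 * (u$2 * v$2)
     + (u$3 * v$3 + u$4 * v$4) / (4 * (p$4)\<^sup>2)"

lemma coord_nth: "coord i $ j = (if i = j then 1 else 0)"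
  by (simp add: coord_def axis_def)

lemma frame_simps:
  "frame 1 p = sqrt (p$4) *\<^sub>R coord 1"
  "frame 2 p = (p$3 / sqrt (p$4)) *\<^sub>R coord 1 + (1 / sqrt (p$4)) *\<^sub>R coord 2"
  "frame 3 p = (2 * p$4) *\<^sub>R coord 3"
  "frame 4 p = (2 * p$4) *\<^sub>R coord 4"
  by (simp_all add: frame_def Let_def)

lemma bilinear_metric_ex: "bilinear (metric_ex p)"
  unfolding bilinear_def
  by (auto intro!: linearI simp: metric_ex_def algebra_simps add_divide_distrib diff_divide_distrib)

lemma metric_ex_orthonormal:
  assumes "p \<in> F4"
  shows "metric_ex p (frame i p) (frame j p) = (if i = j then 1 else 0)"
proof -
  have t: "p$4 > 0" using assms by (simp add: F4_def)
  then have sq: "sqrt (p$4) * sqrt (p$4) = p$4" "sqrt (p$4) \<noteq> 0" "p$4 \<noteq> 0" by auto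
  have "\<forall>i j. metric_ex p (frame i p) (frame j p) = (if i = j then 1 else 0)"
    unfolding forall_4 using sq
    by (simp add: metric_ex_def frame_simps coord_nth field_simps power2_eq_square)
  then show ?thesis by blast
qed

lemma frame_expand:
  assumes "p \<in> F4"
  shows "u = (\<Sum>i\<in>UNIV. metric_ex p u (frame i p) *\<^sub>R frame i p)"
proof -
  have t: "p$4 > 0" using assms by (simp add: F4_def)
  then have sq: "sqrt (p$4) * sqrt (p$4) = p$4" "sqrt (p$4) \<noteq> 0" "p$4 \<noteq> 0" by auto
  show ?thesis
    unfolding vec_eq_iff forall_4 sum_4 using sq
    by (simp add: metric_ex_def frame_simps coord_nth field_simps power2_eq_square)
qed

lemma metric_eq:
  assumes "p \<in> F4"
  shows "metric_F4 p = metric_ex p"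
  unfolding metric_F4_def
proof (rule the_equality)
  show "bilinear (metric_ex p) \<and>
      (\<forall>i j. metric_ex p (frame i p) (frame j p) = (if i = j then 1 else 0))"
    using bilinear_metric_ex metric_ex_orthonormal[OF assms] by blast
next
  fix b :: "real^4 \<Rightarrow> real^4 \<Rightarrow> real"
  assume b: "bilinear b \<and> (\<forall>i j. b (frame i p) (frame j p) = (if i = j then 1 else 0))"
  have *: "c u v = (\<Sum>i\<in>UNIV. \<Sum>j\<in>UNIV. metric_ex p u (frame i p) * (metric_ex p v (frame j p)
        * (if i = j then 1 else 0)))"
    if c: "bilinear c" "\<forall>i j. c (frame i p) (frame j p) = (if i = j then 1 else 0)" for c u v
  proof -
    have "c u v = c (\<Sum>i\<in>UNIV. metric_ex p u (frame i p) *\<^sub>R frame i p)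
                    (\<Sum>i\<in>UNIV. metric_ex p v (frame i p) *\<^sub>R frame i p)"
      using frame_expand[OF assms, of u] frame_expand[OF assms, of v] by simp
    then show ?thesis
      by (simp add: bilinear_sum[OF c(1)] sum.cartesian_product[symmetric]
          bilinear_lmul[OF c(1)] bilinear_rmul[OF c(1)] c(2) mult_ac
          del: UNIV_Times_UNIV)
  qed
  show "b = metric_ex p"
    using b bilinear_metric_ex[of p] metric_ex_orthonormal[OF assms]
    by (intro ext) (rule trans[OF * *[symmetric]]; simp)
qed

lemma metric_orthonormal:
  "p \<in> F4 \<Longrightarrow> metric_F4 p (frame i p) (frame j p) = (if i = j then 1 else 0)"
  by (simp add: metric_eq metric_ex_orthonormal)

lemma open_F4: "open F4"
  unfolding F4_def by (intro open_Collect_less continuous_intros)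

lemma metric_sym: "p \<in> F4 \<Longrightarrow> metric_F4 p u v = metric_F4 p v u"
  by (simp add: metric_eq metric_ex_def mult.commute)

lemma levi_civita_torsion_free:
  fixes g :: "'n::finite metric_field"
  assumes "open S" "p \<in> S" and sym: "\<And>q u v. q \<in> S \<Longrightarrow> g q u v = g q v u"
  shows "levi_civita g X Y p - levi_civita g Y X p =
           frechet_derivative Y (at p) (X p) - frechet_derivative X (at p) (Y p)"
proof -
  have "christoffel g p k i j = christoffel g p k j i" for k i j
  proof -
    have "((\<lambda>q. gram g q $ i $ j) has_derivative f') (at p) \<longleftrightarrow>
          ((\<lambda>q. gram g q $ j $ i) has_derivative f') (at p)" for f'
    proof -
      have "gram g q $ i $ j = gram g q $ j $ i" if "q \<in> S" for q
        using that by (simp add: gram_def sym)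
      then show ?thesis
        by (auto elim!: has_derivative_transform_within_open[OF _ assms(1,2)])
    qed
    then have "dgram g p l i j = dgram g p l j i" for l
      by (simp add: dgram_def frechet_derivative_def)
    then show ?thesis by (simp add: christoffel_def algebra_simps)
  qed
  then have "(\<Sum>i\<in>UNIV. \<Sum>j\<in>UNIV. christoffel g p k i j * X p $ i * Y p $ j) =
             (\<Sum>i\<in>UNIV. \<Sum>j\<in>UNIV. christoffel g p k i j * Y p $ i * X p $ j)" for k
    by (subst sum.swap) (simp add: mult_ac)
  then show ?thesis by (simp add: levi_civita_def)
qed

lemma levi_civita_metric_compatible:
  fixes g :: "'n::finite metric_field"
  assumes "open S" "p \<in> S"
    and bil: "\<And>q. q \<in> S \<Longrightarrow> bilinear (g q)"
    and sym: "\<And>q u v. q \<in> S \<Longrightarrow> g q u v = g q v u"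
    and nondeg: "\<And>u. (\<And>v. g p u v = 0) \<Longrightarrow> u = 0"
    and diff: "\<And>i j. (\<lambda>q. gram g q $ i $ j) differentiable (at p)"
    and Y: "Y differentiable (at p)" and Z: "Z differentiable (at p)"
  shows "frechet_derivative (\<lambda>q. g q (Y q) (Z q)) (at p) (X p) =
           g p (levi_civita g X Y p) (Z p) + g p (Y p) (levi_civita g X Z p)"
proof -
  define G where "G q i j = gram g q $ i $ j" for q i j
  define G' where "G' i j = frechet_derivative (\<lambda>q. G q i j) (at p)" for i j
  have G_sym: "G q i j = G q j i" if "q \<in> S" for q i j
    using that sym by (simp add: G_def gram_def)
  have expand: "g q u v = (\<Sum>i\<in>UNIV. \<Sum>j\<in>UNIV. G q i j * u $ i * v $ j)" if "q \<in> S" for q u v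
  proof -
    have u: "w = (\<Sum>i\<in>UNIV. w $ i *\<^sub>R coord i)" for w :: "real^'n"
      using basis_expansion[of w] by (simp add: coord_def scalar_mult_eq_scaleR)
    have "g q u v = g q (\<Sum>i\<in>UNIV. u $ i *\<^sub>R coord i) (\<Sum>i\<in>UNIV. v $ i *\<^sub>R coord i)"
      using u[of u] u[of v] by simp
    also have "\<dots> = (\<Sum>i\<in>UNIV. \<Sum>j\<in>UNIV. G q i j * u $ i * v $ j)"
      by (simp add: bilinear_sum[OF bil[OF that]] sum.cartesian_product[symmetric] G_def gram_def
          bilinear_lmul[OF bil[OF that]] bilinear_rmul[OF bil[OF that]] mult_ac
          del: UNIV_Times_UNIV)
    finally show ?thesis .
  qed
  have inv: "gram g p ** matrix_inv (gram g p) = mat 1"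
  proof -
    have "gram g p *v u = 0 \<Longrightarrow> u = 0" for u
    proof (rule nondeg)
      fix v
      assume "gram g p *v u = 0"
      then have "(\<Sum>j\<in>UNIV. G p i j * u $ j) = 0" for i
        by (simp add: G_def matrix_vector_mult_def vec_eq_iff)
      then have "(\<Sum>i\<in>UNIV. v $ i * (\<Sum>j\<in>UNIV. G p i j * u $ j)) = 0" by simp
      then have "g p v u = 0"
        by (simp add: expand[OF assms(2)] sum_distrib_left mult_ac)
      then show "g p u v = 0" using sym assms(2) by simp
    qed
    then have "invertible (gram g p)"
      using matrix_left_invertible_ker[of "gram g p"] invertible_left_inverse by blast
    then show ?thesis
      unfolding invertible_def matrix_inv_def by (rule someI2_ex) blast
  qed
  have lower: "(\<Sum>k\<in>UNIV. G p l k * christoffel g p k i j) =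
      1/2 * (dgram g p i j l + dgram g p j i l - dgram g p l i j)" for l i j
  proof -
    let ?d = "\<lambda>m. dgram g p i j m + dgram g p j i m - dgram g p m i j"
    have m: "(\<Sum>k\<in>UNIV. G p l k * matrix_inv (gram g p) $ k $ m) = (if l = m then 1 else 0)" for m
      using arg_cong[OF inv, of "\<lambda>A. A $ l $ m"]
      by (simp add: matrix_matrix_mult_def mat_def G_def)
    have "(\<Sum>k\<in>UNIV. G p l k * christoffel g p k i j) =
        1/2 * (\<Sum>k\<in>UNIV. \<Sum>m\<in>UNIV. G p l k * matrix_inv (gram g p) $ k $ m * ?d m)"
      by (simp add: christoffel_def sum_distrib_left mult_ac)
    also have "\<dots> = 1/2 * (\<Sum>m\<in>UNIV. (\<Sum>k\<in>UNIV. G p l k * matrix_inv (gram g p) $ k $ m) * ?d m)"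
      by (subst sum.swap) (simp add: sum_distrib_right)
    also have "\<dots> = 1/2 * ?d l" by (simp add: m if_distrib[of "\<lambda>x. x * _"] cong: if_cong)
    finally show ?thesis .
  qed
  have dsym: "dgram g p l i j = dgram g p l j i" for l i j
  proof -
    have "G' i j = G' j i"
      unfolding G'_def
      by (rule frechet_derivative_transform_within_open[OF _ assms(1,2)])
        (use diff G_sym in \<open>auto simp: G_def\<close>)
    then show ?thesis by (simp add: dgram_def G'_def G_def)
  qed
  have G'_X: "G' i j w = (\<Sum>k\<in>UNIV. w $ k * dgram g p k i j)" for i j w
  proof -
    have lin: "linear (G' i j)"
      unfolding G'_def using diff by (intro linear_frechet_derivative) (simp add: G_def)
    have "G' i j w = G' i j (\<Sum>k\<in>UNIV. w $ k *\<^sub>R coord k)"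
      using basis_expansion[of w] by (simp add: coord_def scalar_mult_eq_scaleR)
    also have "\<dots> = (\<Sum>k\<in>UNIV. w $ k * G' i j (coord k))"
      by (simp add: linear_sum[OF lin] linear_cmul[OF lin])
    finally show ?thesis by (simp add: dgram_def G'_def G_def)
  qed
  define Y' Z' where "Y' = frechet_derivative Y (at p)" and "Z' = frechet_derivative Z (at p)"
  have hG: "((\<lambda>q. G q i j) has_derivative G' i j) (at p)" for i j
    using diff[of i j] unfolding G'_def G_def by (simp add: frechet_derivative_works)
  have hY: "((\<lambda>q. Y q $ i) has_derivative (\<lambda>h. Y' h $ i)) (at p)" for i
    using Y unfolding Y'_def frechet_derivative_works
    by (rule bounded_linear.has_derivative[OF bounded_linear_vec_nth])
  have hZ: "((\<lambda>q. Z q $ i) has_derivative (\<lambda>h. Z' h $ i)) (at p)" for i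
    using Z unfolding Z'_def frechet_derivative_works
    by (rule bounded_linear.has_derivative[OF bounded_linear_vec_nth])
  have "((\<lambda>q. \<Sum>i\<in>UNIV. \<Sum>j\<in>UNIV. G q i j * Y q $ i * Z q $ j) has_derivative
     (\<lambda>h. \<Sum>i\<in>UNIV. \<Sum>j\<in>UNIV. G p i j * Y p $ i * Z' h $ j +
        (G p i j * Y' h $ i + G' i j h * Y p $ i) * Z p $ j)) (at p)"
    by (intro has_derivative_sum has_derivative_mult hG hY hZ)
  then have "((\<lambda>q. g q (Y q) (Z q)) has_derivative
     (\<lambda>h. \<Sum>i\<in>UNIV. \<Sum>j\<in>UNIV. G p i j * Y p $ i * Z' h $ j +
        (G p i j * Y' h $ i + G' i j h * Y p $ i) * Z p $ j)) (at p)"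
    by (rule has_derivative_transform_within_open[OF _ assms(1,2)]) (simp add: expand)
  then have "frechet_derivative (\<lambda>q. g q (Y q) (Z q)) (at p) (X p) =
     (\<Sum>i\<in>UNIV. \<Sum>j\<in>UNIV. G p i j * Y p $ i * Z' (X p) $ j +
        (G p i j * Y' (X p) $ i + G' i j (X p) * Y p $ i) * Z p $ j)"
    by (rule fun_cong[OF frechet_derivative_at, symmetric])
  also have "\<dots> = g p (Y' (X p)) (Z p) + g p (Y p) (Z' (X p)) +
     (\<Sum>i\<in>UNIV. \<Sum>j\<in>UNIV. G' i j (X p) * Y p $ i * Z p $ j)"
    by (simp add: expand[OF assms(2)] sum.distrib algebra_simps)
  finally have 1: "frechet_derivative (\<lambda>q. g q (Y q) (Z q)) (at p) (X p) =
     g p (Y' (X p)) (Z p) + g p (Y p) (Z' (X p)) +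
     (\<Sum>i\<in>UNIV. \<Sum>j\<in>UNIV. G' i j (X p) * Y p $ i * Z p $ j)" .
  define C where "C W = (\<chi> k. \<Sum>i\<in>UNIV. \<Sum>j\<in>UNIV. christoffel g p k i j * X p $ i * W $ j)"
    for W :: "real^'n"
  have C: "g p (C W) V = (\<Sum>j\<in>UNIV. \<Sum>l\<in>UNIV. \<Sum>i\<in>UNIV.
      1/2 * (dgram g p i j l + dgram g p j i l - dgram g p l i j) * X p $ i * W $ j * V $ l)" for W V
  proof -
    have "g p (C W) V = g p V (C W)" using sym assms(2) by simp
    also have "\<dots> = (\<Sum>l\<in>UNIV. \<Sum>k\<in>UNIV. \<Sum>i\<in>UNIV. \<Sum>j\<in>UNIV.
        G p l k * christoffel g p k i j * (X p $ i * W $ j * V $ l))"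
      by (simp add: expand[OF assms(2)] C_def sum_distrib_left mult_ac)
    also have "\<dots> = (\<Sum>l\<in>UNIV. \<Sum>i\<in>UNIV. \<Sum>k\<in>UNIV. \<Sum>j\<in>UNIV.
        G p l k * christoffel g p k i j * (X p $ i * W $ j * V $ l))"
      by (intro sum.cong refl sum.swap)
    also have "\<dots> = (\<Sum>l\<in>UNIV. \<Sum>i\<in>UNIV. \<Sum>j\<in>UNIV. \<Sum>k\<in>UNIV.
        G p l k * christoffel g p k i j * (X p $ i * W $ j * V $ l))"
      by (intro sum.cong refl sum.swap)
    also have "\<dots> = (\<Sum>l\<in>UNIV. \<Sum>i\<in>UNIV. \<Sum>j\<in>UNIV.
        1/2 * (dgram g p i j l + dgram g p j i l - dgram g p l i j) * (X p $ i * W $ j * V $ l))"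
      by (simp only: sum_distrib_right[symmetric] lower)
    also have "\<dots> = (\<Sum>l\<in>UNIV. \<Sum>j\<in>UNIV. \<Sum>i\<in>UNIV.
        1/2 * (dgram g p i j l + dgram g p j i l - dgram g p l i j) * (X p $ i * W $ j * V $ l))"
      by (intro sum.cong refl sum.swap)
    finally show ?thesis by (subst sum.swap) (simp add: mult_ac)
  qed
  have lc: "levi_civita g X Y p = Y' (X p) + C (Y p)" "levi_civita g X Z p = Z' (X p) + C (Z p)"
    by (simp_all add: levi_civita_def Y'_def Z'_def C_def)
  have 2: "g p (C (Y p)) (Z p) + g p (Y p) (C (Z p)) =
     (\<Sum>i\<in>UNIV. \<Sum>j\<in>UNIV. G' i j (X p) * Y p $ i * Z p $ j)"
  proof -
    have "g p (Y p) (C (Z p)) = (\<Sum>j\<in>UNIV. \<Sum>l\<in>UNIV. \<Sum>i\<in>UNIV.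
      1/2 * (dgram g p i l j + dgram g p l i j - dgram g p j i l) * X p $ i * Z p $ l * Y p $ j)"
      using C[of "Z p" "Y p"] sym assms(2) by (subst sum.swap) simp
    then have "g p (C (Y p)) (Z p) + g p (Y p) (C (Z p)) =
      (\<Sum>j\<in>UNIV. \<Sum>l\<in>UNIV. \<Sum>i\<in>UNIV.
        1/2 * (dgram g p i j l + dgram g p j i l - dgram g p l i j) * X p $ i * Y p $ j * Z p $ l
        + 1/2 * (dgram g p i l j + dgram g p l i j - dgram g p j i l) * X p $ i * Z p $ l * Y p $ j)"
      by (simp only: C sum.distrib)
    also have "\<dots> = (\<Sum>j\<in>UNIV. \<Sum>l\<in>UNIV. \<Sum>i\<in>UNIV. X p $ i * dgram g p i j l * Y p $ j * Z p $ l)"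
    proof (intro sum.cong refl)
      fix j l i
      have "dgram g p i l j = dgram g p i j l" "dgram g p l j i = dgram g p l i j"
        "dgram g p j l i = dgram g p j i l"
        by (rule dsym)+
      then show "1/2 * (dgram g p i j l + dgram g p j i l - dgram g p l i j) * X p $ i * Y p $ j * Z p $ l
        + 1/2 * (dgram g p i l j + dgram g p l i j - dgram g p j i l) * X p $ i * Z p $ l * Y p $ j
        = X p $ i * dgram g p i j l * Y p $ j * Z p $ l"
        by (simp add: field_simps)
    qed
    finally show ?thesis by (simp add: G'_X sum_distrib_right)
  qed
  show ?thesis
    unfolding lc 1
    using 2 by (simp add: bilinear_ladd[OF bil[OF assms(2)]] bilinear_radd[OF bil[OF assms(2)]])
qed

lemma metric_F4_pos_def:
  assumes "p \<in> F4" "u \<noteq> 0"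
  shows "metric_F4 p u u > 0"
proof -
  have t: "p$4 > 0" using assms(1) by (simp add: F4_def)
  have eq: "metric_F4 p u u = (u$1 - p$3 * u$2)\<^sup>2 / p$4 + p$4 * (u$2)\<^sup>2
      + ((u$3)\<^sup>2 + (u$4)\<^sup>2) / (4 * (p$4)\<^sup>2)"
    by (simp add: metric_eq[OF assms(1)] metric_ex_def power2_eq_square)
  have nn: "(u$1 - p$3 * u$2)\<^sup>2 / p$4 \<ge> 0" "p$4 * (u$2)\<^sup>2 \<ge> 0"
    "((u$3)\<^sup>2 + (u$4)\<^sup>2) / (4 * (p$4)\<^sup>2) \<ge> 0"
    using t by simp_all
  have "metric_F4 p u u \<noteq> 0"
  proof
    assume "metric_F4 p u u = 0"
    then have "(u$1 - p$3 * u$2)\<^sup>2 / p$4 = 0" "p$4 * (u$2)\<^sup>2 = 0"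
      "((u$3)\<^sup>2 + (u$4)\<^sup>2) / (4 * (p$4)\<^sup>2) = 0"
      using nn eq by linarith+
    then have "u $ 1 = 0 \<and> u $ 2 = 0 \<and> u $ 3 = 0 \<and> u $ 4 = 0"
      using t by (auto simp: sum_power2_eq_zero_iff)
    then show False using assms(2) by (simp add: vec_eq_iff forall_4)
  qed
  then show ?thesis using nn eq by linarith
qed

lemma gram_metric_F4_differentiable:
  assumes "p \<in> F4"
  shows "(\<lambda>q. gram metric_F4 q $ i $ j) differentiable (at p)"
proof -
  have t: "p$4 > 0" using assms by (simp add: F4_def)
  have nth: "(\<lambda>q::real^4. q $ k) differentiable (at p)" for k
    by (rule bounded_linear_imp_differentiable[OF bounded_linear_vec_nth])
  have "(\<lambda>q. metric_ex q (coord i) (coord j)) differentiable (at p)"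
    unfolding metric_ex_def using t by (intro derivative_intros nth) auto
  then obtain f' where "((\<lambda>q. metric_ex q (coord i) (coord j)) has_derivative f') (at p)"
    by (auto simp: differentiable_def)
  then have "((\<lambda>q. gram metric_F4 q $ i $ j) has_derivative f') (at p)"
    by (rule has_derivative_transform_within_open[OF _ open_F4 assms])
      (simp add: gram_def metric_eq)
  then show ?thesis by (auto simp: differentiable_def)
qed

lemma nabla_torsion_free:
  "p \<in> F4 \<Longrightarrow> nabla X Y p - nabla Y X p =
     frechet_derivative Y (at p) (X p) - frechet_derivative X (at p) (Y p)"
  by (rule levi_civita_torsion_free[OF open_F4]) (auto simp: metric_sym)

lemma nabla_metric_compatible:
  assumes "p \<in> F4" "Y differentiable (at p)" "Z differentiable (at p)"
  shows "frechet_derivative (\<lambda>q. metric_F4 q (Y q) (Z q)) (at p) (X p) =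
           metric_F4 p (nabla X Y p) (Z p) + metric_F4 p (Y p) (nabla X Z p)"
proof (rule levi_civita_metric_compatible[OF open_F4 assms(1)])
  show "bilinear (metric_F4 q)" if "q \<in> F4" for q
    using that bilinear_metric_ex by (simp add: metric_eq)
  show "u = 0" if "\<And>v. metric_F4 p u v = 0" for u
    using metric_F4_pos_def[OF assms(1), of u] that[of u] by force
qed (use assms metric_sym gram_metric_F4_differentiable in auto)

end

(* In the orthonormal frame e_i the connection has constant coefficients g(nabla_{e_i} e_j, e_k),
   found by Koszul's argument.  By Parseval the vertical energy is therefore a quadratic form in the
   frame coefficients of X and their frame derivatives, with density 1/(4 t^2).  Integrating its first
   variation by parts, where div e_4 = -2 is the only nonzero divergence, leaves the pairing of
   V with the rough Laplacian of X, and the fundamental lemma of the calculus of variations, applied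
   to V = (bump function) * e_a, shows that X is harmonic iff the rough Laplacian vanishes.  When the
   coefficients depend only on (s, t), its four components are the stated equations, the last two
   multiplied by 2. *)

theory Submission
  imports Defs
begin

section \<open>Smooth functions\<close>

text \<open>The connection coefficients are constant because the frame spans a Lie algebra: the
  brackets of its members are constant combinations of them, as for a left-invariant frame on a
  solvable Lie group. Two obstacles shape the argument. The boundary of a compact \<open>D\<close>
  can be arbitrarily irregular, so integration by parts cannot rest on a boundary theorem. Instead a
  variation vanishing off \<open>D\<close> is extended by zero to the whole space, where translation
  invariance of Lebesgue measure kills the integral of a directional derivative. Moreover, metric
  and frame are controlled only on the open half-space \<open>F4\<close>, while \<open>Ck_on\<close>
  speaks of abstract Frechet derivatives, so every closed formula has to be carried through
  differentiation by agreement on an open set. Second covariant derivatives of vector fields are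
  never formed: they enter only through frame components, where each derivation along e_i is
  corrected by a constant skew matrix.\<close>

lemma Ck_on_cong:
  assumes "open S" "\<And>p. p \<in> S \<Longrightarrow> f p = g p" "Ck_on k S f"
  shows "Ck_on k S g"
  using assms(2,3)
proof (induction k arbitrary: f g)
  case 0
  then show ?case by (simp cong: continuous_on_cong)
next
  case (Suc k)
  have d: "f differentiable (at p)" if "p \<in> S" for p
    using Suc.prems that by simp
  have "g differentiable (at p)" if p: "p \<in> S" for p
    using d[OF p] unfolding differentiable_def
    by (metis has_derivative_transform_within_open[OF _ assms(1) p] Suc.prems(1))
  moreover have "frechet_derivative f (at p) = frechet_derivative g (at p)" if p: "p \<in> S" for p
    using d[OF p] by (rule frechet_derivative_transform_within_open[OF _ assms(1) p]) (rule Suc.prems(1))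
  ultimately show ?case
    using Suc.prems(2) Suc.IH[where f = "\<lambda>p. frechet_derivative f (at p) v" and
        g = "\<lambda>p. frechet_derivative g (at p) v" for v]
    by simp
qed

text \<open>Lets an explicit derivative stand in for the choice-defined
  \<open>frechet_derivative\<close>, so that smoothness can be read off a differentiation
  rule.\<close>

lemma Ck_on_SucI:
  assumes "open S" "\<And>p. p \<in> S \<Longrightarrow> (f has_derivative f' p) (at p)" "\<And>v. Ck_on k S (\<lambda>p. f' p v)"
  shows "Ck_on (Suc k) S f"
proof -
  have "frechet_derivative f (at p) = f' p" if "p \<in> S" for p
    using frechet_derivative_at[OF assms(2)[OF that]] by simp
  moreover have "f differentiable (at p)" if "p \<in> S" for p
    using assms(2)[OF that] by (auto simp: differentiable_def)
  ultimately show ?thesis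
    using Ck_on_cong[OF assms(1) _ assms(3), where g = "\<lambda>p. frechet_derivative f (at p) v" for v] by simp
qed

lemma Ck_on_SucD:
  assumes "Ck_on (Suc k) S f"
  shows "p \<in> S \<Longrightarrow> (f has_derivative frechet_derivative f (at p)) (at p)"
    and "Ck_on k S (\<lambda>p. frechet_derivative f (at p) v)"
  using assms by (auto simp: frechet_derivative_works[symmetric])

lemma Ck_on_Suc_imp: "Ck_on (Suc k) S f \<Longrightarrow> Ck_on k S f"
proof (induction k arbitrary: f)
  case 0
  then show ?case
    by (auto intro!: continuous_at_imp_continuous_on differentiable_imp_continuous_within)
next
  case (Suc k)
  then show ?case by simp
qed

lemma Ck_on_continuous: "Ck_on k S f \<Longrightarrow> continuous_on S f"
proof (induction k)
  case (Suc k)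
  then show ?case using Ck_on_Suc_imp by blast
qed simp

section \<open>Algebra of C^k functions\<close>

lemma Ck_on_const: "open S \<Longrightarrow> Ck_on k S (\<lambda>_. c)"
proof (induction k arbitrary: c)
  case (Suc k)
  then show ?case by (intro Ck_on_SucI[where f' = "\<lambda>_ _. 0"]) auto
qed simp

lemma Ck_on_bounded_linear:
  assumes "open S" "bounded_linear L" "Ck_on k S f"
  shows "Ck_on k S (\<lambda>p. L (f p))"
  using assms(3)
proof (induction k arbitrary: f)
  case 0
  then show ?case
    by (auto intro: continuous_on_compose2[OF linear_continuous_on[OF assms(2), of UNIV]])
next
  case (Suc k)
  show ?case
    by (rule Ck_on_SucI[OF assms(1), where f' = "\<lambda>p v. L (frechet_derivative f (at p) v)"])
      (use Suc.IH Ck_on_SucD[OF Suc.prems] in \<open>auto intro!: bounded_linear.has_derivative[OF assms(2)]\<close>)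
qed

lemma Ck_on_linear_map: "open S \<Longrightarrow> bounded_linear L \<Longrightarrow> Ck_on k S L"
proof (cases k)
  case (Suc m)
  assume "open S" "bounded_linear L"
  then show ?thesis unfolding Suc
    by (intro Ck_on_SucI[where f' = "\<lambda>_. L"] bounded_linear_imp_has_derivative Ck_on_const)
qed (simp add: linear_continuous_on)

lemma Ck_on_add:
  assumes "open S" "Ck_on k S f" "Ck_on k S g"
  shows "Ck_on k S (\<lambda>p. f p + g p)"
  using assms(2,3)
proof (induction k arbitrary: f g)
  case 0
  then show ?case by (auto intro: continuous_intros)
next
  case (Suc k)
  show ?case
    by (rule Ck_on_SucI[OF assms(1), where
          f' = "\<lambda>p v. frechet_derivative f (at p) v + frechet_derivative g (at p) v"])
      (use Suc.IH Ck_on_SucD[OF Suc.prems(1)] Ck_on_SucD[OF Suc.prems(2)] in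
        \<open>auto intro!: has_derivative_add\<close>)
qed

lemma Ck_on_mult:
  fixes f g :: "'a::real_normed_vector \<Rightarrow> real"
  assumes "open S" "Ck_on k S f" "Ck_on k S g"
  shows "Ck_on k S (\<lambda>p. f p * g p)"
  using assms(2,3)
proof (induction k arbitrary: f g)
  case 0
  then show ?case by (auto intro: continuous_intros)
next
  case (Suc k)
  show ?case
    by (rule Ck_on_SucI[OF assms(1), where
          f' = "\<lambda>p v. f p * frechet_derivative g (at p) v + frechet_derivative f (at p) v * g p"])
      (use Suc.IH Ck_on_SucD[OF Suc.prems(1)] Ck_on_SucD[OF Suc.prems(2)]
          Ck_on_Suc_imp[OF Suc.prems(1)] Ck_on_Suc_imp[OF Suc.prems(2)] in
        \<open>auto intro!: has_derivative_mult Ck_on_add[OF assms(1)]\<close>)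
qed

lemma Ck_on_diff:
  fixes f g :: "'a::real_normed_vector \<Rightarrow> 'b::real_normed_vector"
  assumes "open S" "Ck_on k S f" "Ck_on k S g"
  shows "Ck_on k S (\<lambda>p. f p - g p)"
  using Ck_on_add[OF assms(1,2) Ck_on_bounded_linear[OF assms(1) bounded_linear_minus[OF bounded_linear_ident] assms(3)]]
  by simp

lemma Ck_on_sum:
  assumes "open S" "\<And>i. i \<in> I \<Longrightarrow> Ck_on k S (f i)"
  shows "Ck_on k S (\<lambda>p. \<Sum>i\<in>I. f i p)"
  using assms(2)
  by (induction I rule: infinite_finite_induct) (auto intro: Ck_on_const Ck_on_add assms(1))

lemma Ck_on_nth: "open S \<Longrightarrow> Ck_on k S (\<lambda>p::real^'n. p $ i)"
  by (intro Ck_on_linear_map bounded_linear_vec_nth)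

text \<open>Keeping the real exponent arbitrary closes the family under differentiation. One
  statement then covers the square root, its reciprocal, 1/t and 1/t^2.\<close>

lemma Ck_on_nth_powr: "Ck_on k {p::real^'n. p $ i > 0} (\<lambda>p. p $ i powr a)"
proof (induction k arbitrary: a)
  case 0
  then show ?case by (auto intro!: continuous_intros)
next
  case (Suc k)
  have o: "open {p::real^'n. p $ i > 0}"
    by (intro open_Collect_less continuous_intros)
  show ?case
  proof (rule Ck_on_SucI[OF o, where f' = "\<lambda>p v. a * p $ i powr (a - 1) * v $ i"])
    fix p :: "real^'n"
    assume "p \<in> {p. p $ i > 0}"
    then show "((\<lambda>p. p $ i powr a) has_derivative (\<lambda>v. a * p $ i powr (a - 1) * v $ i)) (at p)"
      by (auto intro!: derivative_eq_intros bounded_linear_imp_has_derivative[OF bounded_linear_vec_nth]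
          simp: powr_diff)
  qed (intro Ck_on_mult o Ck_on_const Suc)
qed

text \<open>The family \<open>exp (-1/x) / x ^ n\<close>, extended by zero, is closed under differentiation up to
  linear combinations, so all its members are smooth.\<close>

definition flat :: "nat \<Rightarrow> real \<Rightarrow> real" where
  "flat n x = (if x > 0 then exp (- (1 / x)) / x ^ n else 0)"

text \<open>From the right, the substitution y = 1/x reduces the limit to y^n / exp y at infinity;
  from the left the function is zero.\<close>

lemma flat_tendsto_0: "((\<lambda>x. flat n x) \<longlongrightarrow> 0) (at 0)"
proof -
  have "((\<lambda>x. flat n x) \<longlongrightarrow> 0) (at_right 0)"
  proof (rule Lim_transform_eventually)
    show "((\<lambda>x::real. exp (- (1 / x)) / x ^ n) \<longlongrightarrow> 0) (at_right 0)"
    proof -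
      have "((\<lambda>y::real. y ^ n / exp y) \<longlongrightarrow> 0) at_top"
        by (rule tendsto_power_div_exp_0)
      then have "((\<lambda>x::real. (inverse x) ^ n / exp (inverse x)) \<longlongrightarrow> 0) (at_right 0)"
        using filterlim_compose filterlim_inverse_at_top_right by blast
      then show ?thesis
        by (simp add: exp_minus divide_simps mult.commute)
    qed
    show "\<forall>\<^sub>F x in at_right 0. exp (- (1 / x)) / x ^ n = flat n x"
      by (simp add: eventually_at_filter flat_def)
  qed
  moreover have "((\<lambda>x. flat n x) \<longlongrightarrow> 0) (at_left 0)"
    by (rule Lim_transform_eventually[OF tendsto_const]) (simp add: eventually_at_filter flat_def)
  ultimately show ?thesis by (simp add: filterlim_split_at)
qed

lemma flat_has_derivative:
  "(flat n has_real_derivative (- real n * flat (n + 1) x + flat (n + 2) x)) (at x)"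
proof (cases "x = 0" rule: case_split[case_names zero nonzero])
  case zero
  \<comment> \<open>Away from 0 the difference quotient at 0 is \<open>flat (n + 1)\<close>, whose
    limit is already known.\<close>
  have "((\<lambda>y. flat n y / y) \<longlongrightarrow> 0) (at 0)"
    by (rule Lim_transform_eventually[OF flat_tendsto_0[of "n + 1"]])
      (simp add: eventually_at_filter flat_def)
  then show ?thesis
    unfolding zero has_field_derivative_iff by (simp add: flat_def)
next
  case nonzero
  show ?thesis
  proof (cases "x > 0")
    case True
    \<comment> \<open>Differentiating the power leaves an exponent with truncated subtraction, which
      is the true predecessor only for a nonzero exponent.\<close>
    have pw: "x ^ m = x * x ^ (m - Suc 0)" if "m \<noteq> 0" for m
      using that by (cases m) auto
    have "((\<lambda>x. exp (- (1 / x)) / x ^ n) has_real_derivative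
        (- real n * flat (n + 1) x + flat (n + 2) x)) (at x)"
      using True
      by (cases n; (auto intro!: derivative_eq_intros simp: flat_def field_simps power2_eq_square)?;
          use pw in blast)
    then show ?thesis
      by (rule has_field_derivative_transform_within_open[OF _ open_greaterThan[of 0]])
        (use True in \<open>auto simp: flat_def\<close>)
  next
    case False
    have "((\<lambda>x. 0) has_real_derivative (- real n * flat (n + 1) x + flat (n + 2) x)) (at x)"
      using False by (simp add: flat_def)
    then show ?thesis
      by (rule has_field_derivative_transform_within_open[OF _ open_lessThan[of 0]])
        (use False nonzero in \<open>auto simp: flat_def\<close>)
  qed
qed

lemma Ck_on_flat:
  fixes q :: "'a::real_normed_vector \<Rightarrow> real"
  assumes "open S" "\<And>k. Ck_on k S q"
  shows "Ck_on k S (\<lambda>p. flat n (q p))"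
proof (induction k arbitrary: n)
  case 0
  have "continuous_on UNIV (flat n)"
    using flat_has_derivative DERIV_continuous by (blast intro: continuous_at_imp_continuous_on)
  then show ?case
    using Ck_on_continuous[OF assms(2)[of 0]] by (auto intro: continuous_on_compose2)
next
  case (Suc k)
  show ?case
  proof (rule Ck_on_SucI[OF assms(1), where f' = "\<lambda>p v.
        (- real n * flat (n + 1) (q p) + flat (n + 2) (q p)) * frechet_derivative q (at p) v"])
    fix p assume "p \<in> S"
    have "(q has_derivative frechet_derivative q (at p)) (at p)"
      using Ck_on_SucD(1)[OF assms(2) \<open>p \<in> S\<close>] .
    from has_derivative_compose[OF this flat_has_derivative[of n "q p", unfolded has_field_derivative_def]]
    show "((\<lambda>p. flat n (q p)) has_derivative (\<lambda>v. (- real n * flat (n + 1) (q p) + flat (n + 2) (q p))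
        * frechet_derivative q (at p) v)) (at p)" .
  qed (intro Ck_on_mult Ck_on_add assms(1) Ck_on_const Suc Ck_on_SucD(2) assms(2))
qed

text \<open>The squared distance is spelled out as a polynomial in the coordinates, so smoothness
  follows from the arithmetic rules without touching the norm, which is not differentiable at the
  centre.\<close>

definition bump :: "real^'n \<Rightarrow> real \<Rightarrow> real^'n \<Rightarrow> real" where
  "bump c r p = flat 0 (r\<^sup>2 - (\<Sum>i\<in>UNIV. (p $ i - c $ i) * (p $ i - c $ i)))"

lemma smooth_on_bump: "open S \<Longrightarrow> smooth_on S (bump c r)"
  unfolding smooth_on_def bump_def
  by (intro allI Ck_on_flat Ck_on_diff Ck_on_sum Ck_on_mult Ck_on_nth Ck_on_const)

lemma bump_eq: "bump c r p = flat 0 (r\<^sup>2 - (dist p c)\<^sup>2)"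
  by (simp add: bump_def dist_norm norm_vec_def L2_set_def sum_nonneg power2_eq_square[symmetric])

lemma bump_pos: "dist p c < r \<Longrightarrow> bump c r p > 0"
  by (simp add: bump_eq flat_def power_strict_mono)

lemma bump_zero: "0 < r \<Longrightarrow> r \<le> dist p c \<Longrightarrow> bump c r p = 0"
  by (simp add: bump_eq flat_def power_mono not_less)

lemma bump_nonneg: "bump c r p \<ge> 0"
  by (simp add: bump_eq flat_def)

section \<open>Integration by parts and the fundamental lemma\<close>

text \<open>Translation invariance gives integral zero to every difference quotient of
  \<open>h\<close> along \<open>v\<close>; dominated convergence passes this on to the
  derivative.\<close>

lemma integral_directional_derivative_eq_0:
  fixes h :: "'a::euclidean_space \<Rightarrow> real"
  assumes h: "\<And>p. (h has_derivative h' p) (at p)"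
    and cont: "continuous_on UNIV (\<lambda>p. h' p v)"
    and K: "compact K" "\<And>p. p \<notin> K \<Longrightarrow> h p = 0"
  shows "(\<integral>p. h' p v \<partial>lborel) = 0"
proof -
  define s where "s n p = (h (p + inverse (real (Suc n)) *\<^sub>R v) - h p) / inverse (real (Suc n))" for n p
  have h_cont: "continuous_on UNIV h"
    using h by (auto intro!: continuous_at_imp_continuous_on has_derivative_continuous)
  then have h_meas [measurable]: "h \<in> borel_measurable borel"
    by (rule borel_measurable_continuous_onI)
  have h_int: "integrable lborel h"
  proof -
    have "(\<lambda>p. indicator K p *\<^sub>R h p) = h"
      by (intro ext) (use K(2) in \<open>auto simp: indicator_def\<close>)
    then show ?thesis
      using borel_integrable_compact[OF K(1) continuous_on_subset[OF h_cont subset_UNIV]] by simp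
  qed
  have shift: "integrable lborel (\<lambda>p. h (p + u))" "(\<integral>p. h (p + u) \<partial>lborel) = (\<integral>p. h p \<partial>lborel)" for u
  proof -
    have m: "(+) u \<in> measurable lborel borel" by simp
    have "integrable (distr lborel borel ((+) u)) h"
      using h_int by (simp add: lborel_distr_plus)
    then show "integrable lborel (\<lambda>p. h (p + u))"
      by (simp add: integrable_distr_eq[OF m h_meas] add.commute)
    show "(\<integral>p. h (p + u) \<partial>lborel) = (\<integral>p. h p \<partial>lborel)"
      using integral_distr[OF m h_meas] by (simp add: lborel_distr_plus add.commute)
  qed
  have s_0: "(\<integral>p. s n p \<partial>lborel) = 0" for n
    unfolding s_def by (simp add: shift h_int)
  have line: "((\<lambda>\<tau>. h (p + \<tau> *\<^sub>R v)) has_real_derivative h' (p + \<tau> *\<^sub>R v) v) (at \<tau>)" for p \<tau>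
  proof -
    have "((\<lambda>\<tau>. p + \<tau> *\<^sub>R v) has_derivative (\<lambda>x. x *\<^sub>R v)) (at \<tau>)"
      by (auto intro!: derivative_eq_intros)
    from has_derivative_compose[OF this h]
    have "((\<lambda>\<tau>. h (p + \<tau> *\<^sub>R v)) has_derivative (\<lambda>x. h' (p + \<tau> *\<^sub>R v) (x *\<^sub>R v))) (at \<tau>)" .
    moreover have "(\<lambda>x. h' (p + \<tau> *\<^sub>R v) (x *\<^sub>R v)) = (*) (h' (p + \<tau> *\<^sub>R v) v)"
      by (rule ext) (simp add: linear_cmul[OF has_derivative_linear[OF h]] mult.commute)
    ultimately show ?thesis
      by (simp add: has_field_derivative_def)
  qed
  have s_lim: "(\<lambda>n. s n p) \<longlonglongrightarrow> h' p v" for p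
  proof -
    have "((\<lambda>\<tau>. (h (p + \<tau> *\<^sub>R v) - h p) / \<tau>) \<longlongrightarrow> h' p v) (at 0)"
      using line[of p 0] by (simp add: has_field_derivative_iff)
    moreover have "filterlim (\<lambda>n. inverse (real (Suc n))) (at 0) sequentially"
      by (rule filterlim_atI[OF LIMSEQ_inverse_real_of_nat]) simp
    ultimately show ?thesis
      unfolding s_def by (rule filterlim_compose)
  qed
  have off: "h' p v = 0" if "p \<notin> K" for p
  proof -
    have "(h has_derivative (\<lambda>_. 0)) (at p)"
      by (rule has_derivative_transform_within_open[where f = "\<lambda>_. 0",
            OF _ open_Compl[OF compact_imp_closed[OF K(1)]]])
        (use K that in auto)
    then show ?thesis using has_derivative_unique[OF h] by metis
  qed
  obtain M where M: "\<And>p. p \<in> K \<Longrightarrow> \<bar>h' p v\<bar> \<le> M"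
    using compact_imp_bounded[OF compact_continuous_image[OF continuous_on_subset[OF cont subset_UNIV] K(1)]]
    by (auto simp: bounded_iff)
  \<comment> \<open>If \<open>K\<close> is empty the bound \<open>M\<close> may be negative, hence
    the maximum with 0.\<close>
  then have M': "\<bar>h' p v\<bar> \<le> max M 0" for p
    using off[of p] by (cases "p \<in> K") (auto intro: le_max_iff_disj[THEN iffD2])
  \<comment> \<open>Sweeping \<open>K\<close> backwards along \<open>v\<close> for times in [0, 1]
    captures the supports of all difference quotients at once, since their step sizes 1/(n+1) are at
    most 1. This makes the dominating function integrable.\<close>
  define K' where "K' = (\<lambda>(p, \<tau>). p - \<tau> *\<^sub>R v) ` (K \<times> {0..1})"
  have "compact K'"
    unfolding K'_def case_prod_unfold
    by (intro compact_continuous_image compact_Times K(1) continuous_intros) simp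
  have s_bound: "norm (s n p) \<le> indicator K' p *\<^sub>R max M 0" for n p
  proof (cases "p \<in> K'")
    case True
    let ?t = "inverse (real (Suc n))"
    obtain z where "h (p + ?t *\<^sub>R v) - h (p + 0 *\<^sub>R v) = (?t - 0) * h' (p + z *\<^sub>R v) v"
      using MVT2[of 0 ?t "\<lambda>\<tau>. h (p + \<tau> *\<^sub>R v)" "\<lambda>\<tau>. h' (p + \<tau> *\<^sub>R v) v"] line by auto
    then have "s n p = h' (p + z *\<^sub>R v) v"
      unfolding s_def by (simp del: of_nat_Suc)
    then show ?thesis using M' True by simp
  next
    case False
    have "h (p + \<tau> *\<^sub>R v) = 0" if "0 \<le> \<tau>" "\<tau> \<le> 1" for \<tau>
    proof (rule K(2), rule)
      assume "p + \<tau> *\<^sub>R v \<in> K"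
      then have "p \<in> K'"
        unfolding K'_def using that by (intro image_eqI[of _ _ "(p + \<tau> *\<^sub>R v, \<tau>)"]) auto
      then show False using False by simp
    qed
    from this[of 0] this[of "inverse (real (Suc n))"] show ?thesis
      by (simp add: s_def inverse_le_1_iff del: of_nat_Suc)
  qed
  have "(\<lambda>n. \<integral>p. s n p \<partial>lborel) \<longlonglongrightarrow> (\<integral>p. h' p v \<partial>lborel)"
  proof (rule integral_dominated_convergence)
    show "(\<lambda>p. h' p v) \<in> borel_measurable lborel"
      using cont by (simp add: borel_measurable_continuous_onI)
    show "s n \<in> borel_measurable lborel" for n
      unfolding s_def by measurable
    show "integrable lborel (\<lambda>p. indicator K' p *\<^sub>R max M 0)"
      by (rule borel_integrable_compact[OF \<open>compact K'\<close>]) simp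
  qed (use s_lim s_bound in auto)
  then show ?thesis
    using LIMSEQ_unique[OF _ tendsto_const] by (simp add: s_0)
qed

text \<open>Extend \<open>W\<close> by zero. The open sets \<open>S\<close> and \<open>- D\<close>
  cover the space, and on both the extension is continuously differentiable: it is \<open>W\<close>
  on the first and zero on the second.\<close>

lemma set_integral_directional_derivative_eq_0:
  fixes W :: "'a::euclidean_space \<Rightarrow> real"
  assumes "open S" "compact D" "D \<subseteq> S" "Ck_on 1 S W" "\<And>p. p \<in> S - D \<Longrightarrow> W p = 0"
  shows "set_lebesgue_integral lborel D (\<lambda>p. frechet_derivative W (at p) v) = 0"
proof -
  define h where "h p = (if p \<in> S then W p else 0)" for p
  define h' where "h' p = (if p \<in> S then frechet_derivative W (at p) else (\<lambda>_. 0))" for p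
  have oD: "open (- D)" using assms(2) by (simp add: compact_imp_closed open_Compl)
  have zero: "(h has_derivative (\<lambda>_. 0)) (at p)" if "p \<notin> D" for p
    by (rule has_derivative_transform_within_open[where f = "\<lambda>_. 0", OF _ oD])
      (use that assms(5) in \<open>auto simp: h_def\<close>)
  have h: "(h has_derivative h' p) (at p)" for p
  proof (cases "p \<in> S")
    case True
    have "(W has_derivative frechet_derivative W (at p)) (at p)"
      using Ck_on_SucD(1)[OF assms(4)[unfolded One_nat_def] True] .
    then have "(h has_derivative frechet_derivative W (at p)) (at p)"
      by (rule has_derivative_transform_within_open[OF _ assms(1) True]) (simp add: h_def)
    then show ?thesis by (simp add: h'_def True)
  next
    case False
    then show ?thesis using zero[of p] assms(3) by (auto simp: h'_def)
  qed
  have off: "h' p v = 0" if "p \<notin> D" for p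
    using has_derivative_unique[OF h zero[OF that]] by simp
  have "continuous_on (S \<union> - D) (\<lambda>p. h' p v)"
  proof (rule continuous_on_open_Un[OF assms(1) oD])
    show "continuous_on S (\<lambda>p. h' p v)"
      using assms(4) by (auto simp: h'_def cong: continuous_on_cong)
    show "continuous_on (- D) (\<lambda>p. h' p v)"
      by (rule continuous_on_eq[OF continuous_on_const[of _ 0]]) (simp add: off)
  qed
  moreover have "S \<union> - D = UNIV" using assms(3) by auto
  ultimately have cont: "continuous_on UNIV (\<lambda>p. h' p v)" by simp
  have "(\<integral>p. h' p v \<partial>lborel) = 0"
    by (rule integral_directional_derivative_eq_0[OF h cont assms(2)])
      (use assms(5) in \<open>auto simp: h_def\<close>)
  moreover have "h' p v = indicator D p *\<^sub>R frechet_derivative W (at p) v" for p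
    using off[of p] assms(3) by (auto simp: indicator_def h'_def)
  ultimately show ?thesis by (simp add: set_lebesgue_integral_def)
qed

lemma set_integrable_compact:
  fixes f :: "'a::euclidean_space \<Rightarrow> real"
  shows "compact D \<Longrightarrow> D \<subseteq> S \<Longrightarrow> continuous_on S f \<Longrightarrow> set_integrable lborel D f"
  unfolding set_integrable_def by (blast intro: borel_integrable_compact continuous_on_subset)

lemma fundamental_lemma_calculus_of_variations:
  fixes f :: "real^'n \<Rightarrow> real"
  assumes S: "open S" and f: "continuous_on S f"
    and orth: "\<And>D \<phi>. compact D \<Longrightarrow> D \<subseteq> S \<Longrightarrow> smooth_on S \<phi> \<Longrightarrow> (\<And>p. p \<in> S - D \<Longrightarrow> \<phi> p = 0) \<Longrightarrow>
      set_lebesgue_integral lborel D (\<lambda>p. \<phi> p * f p) = 0"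
    and c: "c \<in> S"
  shows "f c = 0"
proof (rule ccontr)
  assume ne: "f c \<noteq> 0"
  \<comment> \<open>The factor \<open>f c\<close> treats both signs together: the product is
    positive at \<open>c\<close>, hence on a closed ball around it.\<close>
  have "continuous_on S (\<lambda>p. f c * f p)" using f by (intro continuous_intros)
  then have "open (S \<inter> (\<lambda>p. f c * f p) -` {0<..})"
    using continuous_on_open_vimage[OF S] by (metis open_greaterThan inf_commute)
  moreover have "c \<in> S \<inter> (\<lambda>p. f c * f p) -` {0<..}"
    using c ne by (auto simp: zero_less_mult_iff)
  ultimately obtain r where r: "r > 0" "cball c r \<subseteq> S \<inter> (\<lambda>p. f c * f p) -` {0<..}"
    by (meson open_contains_cball)
  define g where "g p = indicator (cball c r) p *\<^sub>R (f c * (bump c r p * f p))" for p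
  have "set_lebesgue_integral lborel (cball c r) (\<lambda>p. bump c r p * f p) = 0"
    by (rule orth) (use r smooth_on_bump[OF S] in \<open>auto intro!: bump_zero simp: dist_commute\<close>)
  then have "(\<integral>p. g p \<partial>lborel) = 0"
    unfolding g_def set_integral_mult_right[unfolded set_lebesgue_integral_def]
    by (simp add: set_lebesgue_integral_def)
  moreover have "integrable lborel g"
    unfolding g_def
    using smooth_on_bump[OF S, of c r] r
    by (intro borel_integrable_compact compact_cball continuous_intros
        continuous_on_subset[OF f] continuous_on_subset[OF Ck_on_continuous[of 0 S]])
      (auto simp: smooth_on_def)
  moreover have nonneg: "g p \<ge> 0" for p
  proof (cases "p \<in> cball c r")
    case True
    then have "f c * f p \<ge> 0" using r(2) by fastforce
    then have "bump c r p * (f c * f p) \<ge> 0" using bump_nonneg by (rule mult_nonneg_nonneg[rotated])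
    then show ?thesis by (simp add: g_def mult_ac indicator_def)
  qed (simp add: g_def)
  ultimately have g0: "AE p in lborel. g p = 0"
    using integral_nonneg_eq_0_iff_AE[of lborel g] by simp
  have pos: "g p > 0" if "p \<in> ball c r" for p
  proof -
    have "bump c r p > 0" using that by (auto intro: bump_pos simp: dist_commute)
    moreover have "p \<in> cball c r" using that by simp
    then have "f c * f p > 0" using r(2) by blast
    ultimately have "bump c r p * (f c * f p) > 0" by simp
    then show ?thesis using that by (simp add: g_def mult_ac)
  qed
  \<comment> \<open>A nonnegative integrand with integral zero vanishes almost everywhere, yet this
    one is positive on an open ball, which is not a null set.\<close>
  have "AE p in lborel. p \<notin> ball c r"
    by (rule eventually_mono[OF g0]) (use pos in force)
  then have "ball c r \<in> null_sets lborel"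
    using AE_iff_null_sets[of "ball c r" lborel] by simp
  then have "negligible (ball c r)"
    by (simp add: negligible_iff_null_sets null_sets_completionI)
  then show False using open_not_negligible[of "ball c r"] r(1) by simp
qed

section \<open>The connection in the orthonormal frame\<close>

text \<open>The table solves Koszul's formula for the brackets [e_1,e_4] = -e_1, [e_2,e_4] = e_2,
  [e_2,e_3] = -2 e_1, [e_3,e_4] = -2 e_3, the remaining ones with i < j being zero.\<close>

definition conn_coeff :: "4 \<Rightarrow> 4 \<Rightarrow> 4 \<Rightarrow> real" where
  "conn_coeff i j k =
     (if (i, j, k) \<in> {(1,1,4), (1,2,3), (2,1,3), (2,4,2), (3,2,1)} then 1
      else if (i, j, k) \<in> {(1,4,1), (1,3,2), (2,3,1), (2,2,4), (3,1,2)} then -1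
      else if (i, j, k) = (3,3,4) then 2
      else if (i, j, k) = (3,4,3) then -2
      else 0)"

definition frame_deriv :: "4 \<Rightarrow> real^4 \<Rightarrow> real^4 \<Rightarrow> real^4" where
  "frame_deriv j p v =
     (if j = 1 then (v $ 4 / (2 * sqrt (p $ 4))) *\<^sub>R coord 1
      else if j = 2 then (v $ 3 / sqrt (p $ 4) - p $ 3 * v $ 4 / (2 * p $ 4 * sqrt (p $ 4))) *\<^sub>R coord 1
          - (v $ 4 / (2 * p $ 4 * sqrt (p $ 4))) *\<^sub>R coord 2
      else if j = 3 then (2 * v $ 4) *\<^sub>R coord 3
      else (2 * v $ 4) *\<^sub>R coord 4)"

lemma frame_has_derivative:
  assumes "p \<in> F4"
  shows "(frame j has_derivative frame_deriv j p) (at p)"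
proof -
  have t: "p $ 4 > 0" using assms by (simp add: F4_def)
  have nth: "((\<lambda>q::real^4. q $ k) has_derivative (\<lambda>v. v $ k)) (at p)" for k
    by (rule bounded_linear_imp_has_derivative[OF bounded_linear_vec_nth])
  have "\<forall>j. (frame j has_derivative frame_deriv j p) (at p)"
    unfolding forall_4 frame_simps[abs_def] frame_deriv_def using t
    by (auto intro!: derivative_eq_intros nth ext simp: vec_eq_iff coord_nth forall_4 field_simps)
  then show ?thesis by blast
qed

lemma metric_F4_bilinear: "p \<in> F4 \<Longrightarrow> bilinear (metric_F4 p)"
  using bilinear_metric_ex by (simp add: metric_eq)

lemma frame_differentiable: "p \<in> F4 \<Longrightarrow> frame j differentiable (at p)"
  using frame_has_derivative by (auto simp: differentiable_def)

text \<open>The torsion half of the verification of the table; \<open>conn_coeff_skew\<close> is the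
  half belonging to metric compatibility.\<close>

lemma frame_bracket:
  assumes "p \<in> F4"
  shows "metric_F4 p (frame_deriv j p (frame i p) - frame_deriv i p (frame j p)) (frame k p)
    = conn_coeff i j k - conn_coeff j i k"
proof -
  have t: "p $ 4 > 0" using assms by (simp add: F4_def)
  then have sq: "sqrt (p$4) * sqrt (p$4) = p$4" "sqrt (p$4) \<noteq> 0" "p$4 \<noteq> 0" by auto
  have "\<forall>i j k. metric_ex p (frame_deriv j p (frame i p) - frame_deriv i p (frame j p)) (frame k p)
    = conn_coeff i j k - conn_coeff j i k"
    unfolding forall_4 using sq
    by (simp add: metric_ex_def frame_simps frame_deriv_def coord_nth conn_coeff_def field_simps power2_eq_square)
  then show ?thesis by (simp add: metric_eq[OF assms])
qed

lemma conn_coeff_skew: "conn_coeff i j k = - conn_coeff i k j"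
proof -
  have "\<forall>i j k. conn_coeff i j k = - conn_coeff i k j"
    unfolding forall_4 by (simp add: conn_coeff_def)
  then show ?thesis by blast
qed

text \<open>Koszul's argument: a tensor that is skew in its last two indices is determined by its
  skew part in the first two.\<close>

lemma nabla_frame:
  assumes p: "p \<in> F4"
  shows "metric_F4 p (nabla (frame i) (frame j) p) (frame k p) = conn_coeff i j k"
proof -
  define G where "G i j k = metric_F4 p (nabla (frame i) (frame j) p) (frame k p) - conn_coeff i j k"
    for i j k
  note bil = metric_F4_bilinear[OF p]
  have skew: "G i j k = - G i k j" for i j k
  proof -
    have "((\<lambda>q. metric_F4 q (frame j q) (frame k q)) has_derivative (\<lambda>_. 0)) (at p)"
      by (rule has_derivative_transform_within_open[OF has_derivative_const open_F4 p])
        (simp add: metric_orthonormal)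
    then have "frechet_derivative (\<lambda>q. metric_F4 q (frame j q) (frame k q)) (at p) = (\<lambda>_. 0)"
      by (rule frechet_derivative_at[symmetric])
    then have "metric_F4 p (nabla (frame i) (frame j) p) (frame k p)
        + metric_F4 p (frame j p) (nabla (frame i) (frame k) p) = 0"
      using nabla_metric_compatible[OF p frame_differentiable[OF p] frame_differentiable[OF p],
          where X = "frame i"] by metis
    then show ?thesis
      using conn_coeff_skew[of i j k] by (simp add: G_def metric_sym[OF p, of "frame j p"])
  qed
  have sym: "G i j k = G j i k" for i j k
  proof -
    have "metric_F4 p (nabla (frame i) (frame j) p - nabla (frame j) (frame i) p) (frame k p)
      = conn_coeff i j k - conn_coeff j i k"
      unfolding nabla_torsion_free[OF p] frame_bracket[OF p, symmetric]
      by (simp add: frechet_derivative_at[OF frame_has_derivative[OF p], symmetric])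
    then show ?thesis
      by (simp add: G_def bilinear_lsub[OF bil])
  qed
  \<comment> \<open>Alternating the two symmetries six times returns to the same indices after three
    sign changes, so the error equals its own negative.\<close>
  have "G i j k = 0"
    using skew[of i j k] sym[of i k j] skew[of k i j] sym[of k j i] skew[of j k i] sym[of j i k]
    by linarith
  then show ?thesis by (simp add: G_def)
qed

text \<open>Built on \<open>metric_ex\<close>, which is bilinear at every point, so that linearity
  in the field holds as an equation between functions and not merely on \<open>F4\<close>.\<close>

definition frame_coeff :: "(real^4 \<Rightarrow> real^4) \<Rightarrow> 4 \<Rightarrow> real^4 \<Rightarrow> real" where
  "frame_coeff Y a p = metric_ex p (Y p) (frame a p)"

definition frame_dir :: "4 \<Rightarrow> (real^4 \<Rightarrow> real) \<Rightarrow> real^4 \<Rightarrow> real" where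
  "frame_dir i f p = frechet_derivative f (at p) (frame i p)"

text \<open>For \<open>y = frame_coeff Y\<close> this is the component of \<open>\<nabla>\<^bsub>e\<^sub>i\<^esub> Y\<close> along \<open>e\<^sub>a\<close>.\<close>

definition cov_coeff :: "4 \<Rightarrow> (4 \<Rightarrow> real^4 \<Rightarrow> real) \<Rightarrow> 4 \<Rightarrow> real^4 \<Rightarrow> real" where
  "cov_coeff i y a p = frame_dir i (y a) p + (\<Sum>b\<in>UNIV. conn_coeff i b a * y b p)"

lemma frame_coeff_differentiable:
  assumes p: "p \<in> F4" and Y: "Y differentiable (at p)"
  shows "frame_coeff Y a differentiable (at p)"
proof -
  have t: "p$4 > 0" using p by (simp add: F4_def)
  have nth: "(\<lambda>q::real^4. q $ k) differentiable (at p)" for k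
    by (rule bounded_linear_imp_differentiable[OF bounded_linear_vec_nth])
  have nth_comp: "(\<lambda>q. (Z q :: real^4) $ k) differentiable (at p)" if "Z differentiable (at p)" for k Z
    using that by (auto simp: differentiable_def intro: bounded_linear.has_derivative[OF bounded_linear_vec_nth])
  show ?thesis
    unfolding frame_coeff_def[abs_def] metric_ex_def using t
    by (intro derivative_intros nth nth_comp[OF Y] nth_comp[OF frame_differentiable[OF p]]) auto
qed

text \<open>Metric compatibility differentiates g(Y, e_a) along e_i. In the leftover term
  \<open>Y\<close> is expanded in the frame, and skewness of \<open>conn_coeff\<close> turns the
  subtraction into the correction of \<open>cov_coeff\<close>.\<close>

lemma nabla_frame_coeff:
  assumes p: "p \<in> F4" and Y: "Y differentiable (at p)"
  shows "metric_F4 p (nabla (frame i) Y p) (frame a p) = cov_coeff i (frame_coeff Y) a p"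
proof -
  note bil = metric_F4_bilinear[OF p]
  have "frechet_derivative (frame_coeff Y a) (at p)
      = frechet_derivative (\<lambda>q. metric_F4 q (Y q) (frame a q)) (at p)"
    by (rule frechet_derivative_transform_within_open[OF frame_coeff_differentiable[OF p Y] open_F4 p])
      (simp add: frame_coeff_def metric_eq)
  then have 1: "frame_dir i (frame_coeff Y a) p =
      metric_F4 p (nabla (frame i) Y p) (frame a p) + metric_F4 p (Y p) (nabla (frame i) (frame a) p)"
    unfolding frame_dir_def
    using nabla_metric_compatible[OF p Y frame_differentiable[OF p], where X = "frame i"] by simp
  have "metric_F4 p (Y p) (nabla (frame i) (frame a) p) =
      metric_F4 p (\<Sum>b\<in>UNIV. frame_coeff Y b p *\<^sub>R frame b p) (nabla (frame i) (frame a) p)"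
    using frame_expand[OF p, of "Y p"] by (simp add: frame_coeff_def)
  also have "\<dots> = (\<Sum>b\<in>UNIV. frame_coeff Y b p * conn_coeff i a b)"
    using bil unfolding bilinear_def
    by (simp add: linear_sum[of "\<lambda>u. metric_F4 p u _"] linear_cmul[of "\<lambda>u. metric_F4 p u _"]
        metric_sym[OF p, of "frame _ p"] nabla_frame[OF p])
  also have "\<dots> = - (\<Sum>b\<in>UNIV. conn_coeff i b a * frame_coeff Y b p)"
    by (subst conn_coeff_skew) (simp add: sum_negf mult.commute)
  finally show ?thesis using 1 by (simp add: cov_coeff_def)
qed

lemma metric_ex_parseval:
  assumes "p \<in> F4"
  shows "metric_ex p u u = (\<Sum>a\<in>UNIV. (metric_ex p u (frame a p))\<^sup>2)"
proof -
  note lin = bilinear_metric_ex[of p, unfolded bilinear_def]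
  have "metric_ex p u u = metric_ex p u (\<Sum>a\<in>UNIV. metric_ex p u (frame a p) *\<^sub>R frame a p)"
    using frame_expand[OF assms, of u] by simp
  also have "\<dots> = (\<Sum>a\<in>UNIV. (metric_ex p u (frame a p))\<^sup>2)"
    using lin by (simp add: linear_sum linear_cmul power2_eq_square)
  finally show ?thesis .
qed

lemma norm_nabla_sq_eq:
  assumes p: "p \<in> F4" and Y: "Y differentiable (at p)"
  shows "norm_nabla_sq Y p = (\<Sum>i\<in>UNIV. \<Sum>a\<in>UNIV. (cov_coeff i (frame_coeff Y) a p)\<^sup>2)"
  unfolding norm_nabla_sq_def nabla_frame_coeff[OF p Y, symmetric]
  by (simp add: metric_eq[OF p] metric_ex_parseval[OF p])

text \<open>With the frame vectors as rows of \<open>A\<close>, orthonormality says that A G A^T is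
  the identity for the Gram matrix G, so det G is the inverse square of det A, and \<open>A\<close>
  is triangular.\<close>

lemma volume_density_F4:
  assumes p: "p \<in> F4"
  shows "volume_density metric_F4 p = 1 / (4 * (p $ 4)\<^sup>2)"
proof -
  have t: "p $ 4 > 0" using assms by (simp add: F4_def)
  define A where "A = (\<chi> i j. frame i p $ j)"
  \<comment> \<open>In the index type the numeral 4 is 0, so the order is not the expected one.
    Triangularity depends only on 1 < 2, because the sole off-diagonal entry of \<open>A\<close>
    sits at (2, 1).\<close>
  have ord: "(1::4) < 2" by (simp add: less_bit0_def bit0.Rep_numeral bit0.Rep_1)
  have "det A = (\<Prod>i\<in>UNIV. A $ i $ i)"
  proof (rule det_lowerdiagonal)
    show "A $ i $ j = 0" if "i < j" for i j
    proof -
      have "\<forall>i j. A $ i $ j = 0 \<or> i = j \<or> i = 2 \<and> j = 1"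
        unfolding forall_4 by (simp add: A_def frame_simps coord_nth)
      then have "A $ i $ j = 0 \<or> i = j \<or> i = 2 \<and> j = 1" by blast
      then show ?thesis using that ord by auto
    qed
  qed
  also have "\<dots> = A $ 1 $ 1 * (A $ 2 $ 2 * (A $ 3 $ 3 * A $ 4 $ 4))"
    unfolding UNIV_4 by simp
  also have "\<dots> = 4 * (p $ 4)\<^sup>2"
    using t by (simp add: A_def frame_simps coord_nth power2_eq_square)
  finally have "det A = 4 * (p $ 4)\<^sup>2" .
  moreover have gram: "A ** gram metric_F4 p ** transpose A = mat 1"
  proof -
    have "(\<Sum>k\<in>UNIV. \<Sum>l\<in>UNIV. A $ i $ l * gram metric_F4 p $ l $ k * A $ j $ k)
      = metric_F4 p (frame i p) (frame j p)" for i j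
    proof -
      have "frame i p = (\<Sum>l\<in>UNIV. A $ i $ l *\<^sub>R coord l)" for i
        using basis_expansion[of "frame i p"] by (simp add: coord_def scalar_mult_eq_scaleR A_def)
      then show ?thesis
        using metric_F4_bilinear[OF p] unfolding bilinear_def
        by (simp add: linear_sum linear_sum[of "\<lambda>u. metric_F4 p u _"]
            linear_cmul[of "\<lambda>u. metric_F4 p u _"] linear_cmul gram_def sum_distrib_left mult_ac)
    qed
    then show ?thesis
      by (simp add: vec_eq_iff matrix_matrix_mult_def mat_def transpose_def metric_orthonormal[OF p]
          sum_distrib_right)
  qed
  have "det A * det (gram metric_F4 p) * det A = 1"
    using arg_cong[OF gram, of det] by (simp add: det_mul)
  ultimately have "det (gram metric_F4 p) = (1 / (4 * (p $ 4)\<^sup>2))\<^sup>2"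
    using t by (simp add: field_simps power2_eq_square)
  then show ?thesis by (simp add: volume_density_def)
qed

lemma Ck_on_F4_powr: "Ck_on k F4 (\<lambda>p. p $ 4 powr a)"
  unfolding F4_def by (rule Ck_on_nth_powr)

section \<open>The first variation of the vertical energy\<close>

lemma powr_neg_eq:
  fixes t :: real
  assumes "t > 0"
  shows "t powr - (1/2) = 1 / sqrt t" "t powr - 1 = 1 / t" "t powr - 2 = 1 / t\<^sup>2"
  using assms powr_minus_divide[of t "1/2"] powr_minus_divide[of t 1] powr_minus_divide[of t 2]
    powr_half_sqrt[of t] powr_one[of t] powr_numeral[of t "num.Bit0 num.One"]
  by (metis less_imp_le)+

lemma Ck_on_frame_nth: "Ck_on k F4 (\<lambda>p. frame i p $ j)"
proof -
  have 1: "Ck_on k F4 (\<lambda>p. sqrt (p $ 4))"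
    by (rule Ck_on_cong[OF open_F4 _ Ck_on_F4_powr[of k "1/2"]]) (simp add: F4_def powr_half_sqrt)
  have 2: "Ck_on k F4 (\<lambda>p. 1 / sqrt (p $ 4))"
    by (rule Ck_on_cong[OF open_F4 _ Ck_on_F4_powr[of k "-(1/2)"]]) (simp add: F4_def powr_neg_eq(1))
  have 3: "Ck_on k F4 (\<lambda>p. p $ 3 / sqrt (p $ 4))"
    using Ck_on_mult[OF open_F4 Ck_on_nth[OF open_F4] 2] by simp
  have 4: "Ck_on k F4 (\<lambda>p. 2 * p $ 4)"
    by (intro Ck_on_mult Ck_on_const Ck_on_nth open_F4)
  have "\<forall>i j. Ck_on k F4 (\<lambda>p. frame i p $ j)"
    unfolding forall_4 using 1 2 3 4 by (simp add: frame_simps coord_nth Ck_on_const open_F4)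
  then show ?thesis by blast
qed

lemma Ck_on_frame_coeff:
  assumes "Ck_on k F4 Y"
  shows "Ck_on k F4 (frame_coeff Y a)"
proof -
  have Y: "Ck_on k F4 (\<lambda>p. Y p $ j)" for j
    by (rule Ck_on_bounded_linear[OF open_F4 bounded_linear_vec_nth assms])
  have "Ck_on k F4 (\<lambda>p. (Y p $ 1 - p $ 3 * Y p $ 2) * (frame a p $ 1 - p $ 3 * frame a p $ 2)
      * p $ 4 powr (-1) + p $ 4 * (Y p $ 2 * frame a p $ 2)
      + (Y p $ 3 * frame a p $ 3 + Y p $ 4 * frame a p $ 4) * (1/4 * p $ 4 powr (-2)))"
    by (intro Ck_on_add Ck_on_diff Ck_on_mult Ck_on_F4_powr Ck_on_frame_nth Ck_on_nth Ck_on_const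
        open_F4 Y)
  then show ?thesis
    by (rule Ck_on_cong[OF open_F4, rotated])
      (simp add: frame_coeff_def metric_ex_def F4_def powr_neg_eq(2,3))
qed

lemma linear_expand_coord:
  fixes f :: "real^'n \<Rightarrow> real"
  assumes "linear f"
  shows "f v = (\<Sum>k\<in>UNIV. v $ k * f (coord k))"
proof -
  have "f v = f (\<Sum>k\<in>UNIV. v $ k *\<^sub>R coord k)"
    using basis_expansion[of v] by (simp add: coord_def scalar_mult_eq_scaleR)
  then show ?thesis by (simp add: linear_sum[OF assms] linear_cmul[OF assms])
qed

text \<open>\<open>Ck_on\<close> controls derivatives in fixed directions only, whereas the frame
  direction varies with the point; hence the expansion in coordinate directions.\<close>

lemma Ck_on_frame_dir:
  assumes "Ck_on (Suc k) F4 f"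
  shows "Ck_on k F4 (frame_dir i f)"
proof (rule Ck_on_cong[OF open_F4])
  show "Ck_on k F4 (\<lambda>p. \<Sum>j\<in>UNIV. frame i p $ j * frechet_derivative f (at p) (coord j))"
    by (intro Ck_on_sum Ck_on_mult Ck_on_frame_nth Ck_on_SucD(2) assms open_F4)
  fix p assume "p \<in> F4"
  then show "(\<Sum>j\<in>UNIV. frame i p $ j * frechet_derivative f (at p) (coord j)) = frame_dir i f p"
    unfolding frame_dir_def
    using linear_expand_coord[OF has_derivative_linear[OF Ck_on_SucD(1)[OF assms]]] by metis
qed

lemma Ck_on_cov_coeff:
  assumes "\<And>a. Ck_on (Suc k) F4 (y a)"
  shows "Ck_on k F4 (cov_coeff i y a)"
  unfolding cov_coeff_def[abs_def]
  by (intro Ck_on_add Ck_on_sum Ck_on_mult Ck_on_const Ck_on_frame_dir open_F4 assms Ck_on_Suc_imp)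

section \<open>Derivatives along the frame fields\<close>

lemma frame_dir_add:
  assumes "f differentiable (at p)" "g differentiable (at p)"
  shows "frame_dir i (\<lambda>q. f q + g q) p = frame_dir i f p + frame_dir i g p"
proof -
  have "((\<lambda>q. f q + g q) has_derivative
      (\<lambda>v. frechet_derivative f (at p) v + frechet_derivative g (at p) v)) (at p)"
    using assms by (intro has_derivative_add) (simp_all add: frechet_derivative_works[symmetric])
  from frechet_derivative_at[OF this, symmetric] show ?thesis
    by (simp add: frame_dir_def)
qed

lemma frame_dir_mult:
  assumes "f differentiable (at p)" "g differentiable (at p)"
  shows "frame_dir i (\<lambda>q. f q * g q) p = f p * frame_dir i g p + frame_dir i f p * g p"
proof -
  have "((\<lambda>q. f q * g q) has_derivative
      (\<lambda>v. f p * frechet_derivative g (at p) v + frechet_derivative f (at p) v * g p)) (at p)"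
    using assms by (intro has_derivative_mult) (simp_all add: frechet_derivative_works[symmetric])
  from frechet_derivative_at[OF this, symmetric] show ?thesis
    by (simp add: frame_dir_def)
qed

lemma frame_dir_const: "frame_dir i (\<lambda>_. c) p = 0"
  by (simp add: frame_dir_def)

lemma frame_dir_sum:
  assumes "\<And>a. a \<in> I \<Longrightarrow> f a differentiable (at p)"
  shows "frame_dir i (\<lambda>q. \<Sum>a\<in>I. f a q) p = (\<Sum>a\<in>I. frame_dir i (f a) p)"
proof -
  have "((\<lambda>q. \<Sum>a\<in>I. f a q) has_derivative (\<lambda>v. \<Sum>a\<in>I. frechet_derivative (f a) (at p) v)) (at p)"
    using assms by (intro has_derivative_sum) (simp add: frechet_derivative_works[symmetric])
  from frechet_derivative_at[OF this, symmetric] show ?thesis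
    by (simp add: frame_dir_def)
qed

lemma frame_dir_cong:
  assumes "p \<in> F4" "\<And>q. q \<in> F4 \<Longrightarrow> f q = g q" "f differentiable (at p)"
  shows "frame_dir i f p = frame_dir i g p"
  using frechet_derivative_transform_within_open[OF assms(3) open_F4 assms(1,2)]
  by (simp add: frame_dir_def)

lemma frame_coeff_linear:
  "frame_coeff (\<lambda>q. Y q + c *\<^sub>R Z q) a = (\<lambda>p. frame_coeff Y a p + c * frame_coeff Z a p)"
  using bilinear_metric_ex unfolding frame_coeff_def
  by (auto simp: bilinear_ladd bilinear_lmul)

lemma cov_coeff_linear:
  assumes "\<And>a. y a differentiable (at p)" "\<And>a. z a differentiable (at p)"
  shows "cov_coeff i (\<lambda>a q. y a q + c * z a q) a p = cov_coeff i y a p + c * cov_coeff i z a p"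
  using assms
  by (simp add: cov_coeff_def frame_dir_add frame_dir_mult frame_dir_const
      differentiable_mult sum.distrib algebra_simps sum_distrib_left)

section \<open>Divergence theorem and Green's formula\<close>

lemma set_integral_sum_eq_0:
  fixes f :: "'i \<Rightarrow> 'a::euclidean_space \<Rightarrow> real"
  assumes "\<And>i. i \<in> I \<Longrightarrow> set_integrable lborel D (f i)"
    and "\<And>i. i \<in> I \<Longrightarrow> set_lebesgue_integral lborel D (f i) = 0"
  shows "set_lebesgue_integral lborel D (\<lambda>p. \<Sum>i\<in>I. f i p) = 0"
  using assms unfolding set_lebesgue_integral_def set_integrable_def scaleR_sum_right
  by (simp add: Bochner_Integration.integral_sum)

text \<open>The correction term is the coordinate divergence of \<open>e\<^sub>i\<close>, taken with respect to Lebesgue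
  measure and not the Riemannian volume.\<close>

lemma set_integral_frame_divergence:
  assumes D: "compact D" "D \<subseteq> F4" and H: "Ck_on 1 F4 H" "\<And>p. p \<in> F4 - D \<Longrightarrow> H p = 0"
  shows "set_lebesgue_integral lborel D (\<lambda>p. frame_dir i H p + (if i = 4 then 2 * H p else 0)) = 0"
proof -
  \<comment> \<open>These are the coordinate components of the field H e_i, so the sum of their
    partial derivatives is its coordinate divergence.\<close>
  define W where "W k p = frame i p $ k * H p" for k p
  have CkW: "Ck_on 1 F4 (W k)" for k
    unfolding W_def by (intro Ck_on_mult open_F4 Ck_on_frame_nth H)
  have int: "set_integrable lborel D (\<lambda>p. frechet_derivative (W k) (at p) v)" for k v
    using D CkW[of k] by (intro set_integrable_compact[of D F4]) auto
  have zero: "set_lebesgue_integral lborel D (\<lambda>p. frechet_derivative (W k) (at p) v) = 0" for k v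
    by (rule set_integral_directional_derivative_eq_0[OF open_F4 D CkW]) (simp add: W_def H(2))
  have eq: "frame_dir i H p + (if i = 4 then 2 * H p else 0)
      = (\<Sum>k\<in>UNIV. frechet_derivative (W k) (at p) (coord k))" if p: "p \<in> F4" for p
  proof -
    have dH: "(H has_derivative frechet_derivative H (at p)) (at p)"
      using Ck_on_SucD(1)[OF H(1)[unfolded One_nat_def] p] .
    have "(W k has_derivative (\<lambda>v. frame i p $ k * frechet_derivative H (at p) v + frame_deriv i p v $ k * H p)) (at p)"
      for k
      unfolding W_def
      by (intro has_derivative_mult dH bounded_linear.has_derivative[OF bounded_linear_vec_nth]
          frame_has_derivative p)
    from frechet_derivative_at[OF this, symmetric]
    have "(\<Sum>k\<in>UNIV. frechet_derivative (W k) (at p) (coord k))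
      = (\<Sum>k\<in>UNIV. frame i p $ k * frechet_derivative H (at p) (coord k))
        + (\<Sum>k\<in>UNIV. frame_deriv i p (coord k) $ k) * H p"
      by (simp add: sum.distrib sum_distrib_right)
    also have "(\<Sum>k\<in>UNIV. frame i p $ k * frechet_derivative H (at p) (coord k)) = frame_dir i H p"
      unfolding frame_dir_def
      by (rule linear_expand_coord[OF has_derivative_linear[OF dH], symmetric])
    also have "(\<Sum>k\<in>UNIV. frame_deriv i p (coord k) $ k) = (if i = 4 then 2 else 0)"
    proof -
      \<comment> \<open>Only e_4 = 2t d/dt has a coefficient depending on the coordinate it
        differentiates.\<close>
      have "\<forall>i. (\<Sum>k\<in>UNIV. frame_deriv i p (coord k) $ k) = (if i = 4 then 2 else 0)"
        unfolding forall_4 sum_4 by (simp add: frame_deriv_def coord_nth)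
      then show ?thesis by blast
    qed
    finally show ?thesis by simp
  qed
  have "set_lebesgue_integral lborel D (\<lambda>p. frame_dir i H p + (if i = 4 then 2 * H p else 0))
    = set_lebesgue_integral lborel D (\<lambda>p. \<Sum>k\<in>UNIV. frechet_derivative (W k) (at p) (coord k))"
    by (rule set_lebesgue_integral_cong) (use D eq in \<open>auto dest: compact_imp_closed\<close>)
  also have "\<dots> = 0"
    by (rule set_integral_sum_eq_0[OF int zero])
  finally show ?thesis .
qed

text \<open>The last term comes from \<open>\<Sum>\<^sub>i \<nabla>\<^bsub>e\<^sub>i\<^esub> e\<^sub>i = 2 e\<^sub>4\<close>.\<close>

definition rough_laplacian_coeff :: "(4 \<Rightarrow> real^4 \<Rightarrow> real) \<Rightarrow> 4 \<Rightarrow> real^4 \<Rightarrow> real" where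
  "rough_laplacian_coeff y a p =
     (\<Sum>i\<in>UNIV. frame_dir i (cov_coeff i y a) p + (\<Sum>c\<in>UNIV. conn_coeff i c a * cov_coeff i y c p))
     - 2 * cov_coeff 4 y a p"

abbreviation density :: "real^4 \<Rightarrow> real" where
  "density p \<equiv> 1 / (4 * (p $ 4)\<^sup>2)"

lemma Ck_on_density: "Ck_on k F4 density"
proof (rule Ck_on_cong[OF open_F4])
  show "Ck_on k F4 (\<lambda>p. 1/4 * p $ 4 powr (-2))"
    by (intro Ck_on_mult Ck_on_const Ck_on_F4_powr open_F4)
qed (simp add: F4_def powr_neg_eq(3))

lemma frame_dir_density:
  assumes "p \<in> F4"
  shows "frame_dir i density p = (if i = 4 then - 4 * density p else 0)"
proof -
  have t: "p $ 4 > 0" using assms by (simp add: F4_def)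
  have "((\<lambda>x. 1 / (4 * x\<^sup>2)) has_real_derivative - 1 / (2 * (p $ 4) ^ 3)) (at (p $ 4))"
    using t by (auto intro!: derivative_eq_intros simp: field_simps power2_eq_square power3_eq_cube)
  from has_derivative_compose[OF bounded_linear_imp_has_derivative[OF bounded_linear_vec_nth]
      this[unfolded has_field_derivative_def]]
  have "(density has_derivative (\<lambda>v. - 1 / (2 * (p $ 4) ^ 3) * v $ 4)) (at p)" .
  from frechet_derivative_at[OF this, symmetric]
  have "frame_dir i density p = - frame i p $ 4 / (2 * (p $ 4) ^ 3)"
    by (simp add: frame_dir_def)
  moreover have "\<forall>i. - frame i p $ 4 / (2 * (p $ 4) ^ 3) = (if i = 4 then - 4 * density p else 0)"
    unfolding forall_4 using t
    by (simp add: frame_simps coord_nth field_simps power2_eq_square power3_eq_cube)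
  ultimately show ?thesis by simp
qed

text \<open>The field with frame components \<open>H i\<close> vanishes off \<open>D\<close>. By the
  product rule its coordinate divergence is the pairing of the two covariant derivatives plus the
  pairing of \<open>v\<close> with the rough Laplacian of \<open>y\<close>, both weighted by
  \<open>density\<close>.\<close>

lemma set_integral_green:
  assumes D: "compact D" "D \<subseteq> F4"
    and y: "\<And>a. Ck_on 2 F4 (y a)" and v: "\<And>a. Ck_on 1 F4 (v a)"
    and v0: "\<And>a p. p \<in> F4 - D \<Longrightarrow> v a p = 0"
  shows "set_lebesgue_integral lborel D (\<lambda>p. (\<Sum>i\<in>UNIV. \<Sum>a\<in>UNIV. cov_coeff i y a p * cov_coeff i v a p) * density p)
    = - set_lebesgue_integral lborel D (\<lambda>p. (\<Sum>a\<in>UNIV. v a p * rough_laplacian_coeff y a p) * density p)"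
    (is "set_lebesgue_integral _ _ ?f = - set_lebesgue_integral _ _ ?g")
proof -
  define H where "H i p = (\<Sum>a\<in>UNIV. cov_coeff i y a p * v a p) * density p" for i p
  have y2: "Ck_on (Suc (Suc 0)) F4 (y a)" for a
    using y[of a] by (simp only: numeral_2_eq_2)
  have A: "Ck_on 1 F4 (cov_coeff i y a)" for i a
    unfolding One_nat_def by (rule Ck_on_cov_coeff[OF y2])
  have CkH: "Ck_on 1 F4 (H i)" for i
    unfolding H_def by (intro Ck_on_mult Ck_on_sum A v open_F4 Ck_on_density)
  have H0: "H i p = 0" if "p \<in> F4 - D" for i p
    by (simp add: H_def v0[OF that])
  have eq: "?f p + ?g p = (\<Sum>i\<in>UNIV. frame_dir i (H i) p + (if i = 4 then 2 * H i p else 0))"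
    if p: "p \<in> F4" for p
  proof -
    define C where "C i a = cov_coeff i y a p" for i a
    define C' where "C' i a = frame_dir i (cov_coeff i y a) p" for i a
    define u where "u a = v a p" for a
    define u' where "u' i a = frame_dir i (v a) p" for i a
    have dA: "cov_coeff i y a differentiable (at p)" for i a
      using A[of i a] p by simp
    have dv: "v a differentiable (at p)" for a
      using v[of a] p by simp
    have dd: "density differentiable (at p)"
      using Ck_on_density[of 1] p by simp
    have dAv: "(\<lambda>q. cov_coeff i y a q * v a q) differentiable (at p)" for i a
      by (intro differentiable_mult dA dv)
    have dS: "(\<lambda>q. \<Sum>a\<in>UNIV. cov_coeff i y a q * v a q) differentiable (at p)" for i
      using dAv by (intro differentiable_sum) auto
    have S: "frame_dir i (\<lambda>q. \<Sum>a\<in>UNIV. cov_coeff i y a q * v a q) p = (\<Sum>a\<in>UNIV. C i a * u' i a + C' i a * u a)"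
      for i
      by (subst frame_dir_sum) (simp_all add: dAv frame_dir_mult[OF dA dv] C_def C'_def u_def u'_def)
    \<comment> \<open>For i = 4 the coordinate divergence 2 and the logarithmic derivative -4 of the
      density combine to -2, the Riemannian divergence of e_4.\<close>
    have "frame_dir i (H i) p + (if i = 4 then 2 * H i p else 0) =
       ((\<Sum>a\<in>UNIV. C i a * u' i a + C' i a * u a) - (if i = 4 then 2 * (\<Sum>a\<in>UNIV. C i a * u a) else 0)) * density p"
      for i
      unfolding H_def frame_dir_mult[OF dS dd] S frame_dir_density[OF p]
      by (cases "i = 4") (simp_all add: C_def u_def diff_divide_distrib left_diff_distrib mult.commute)
    then have "(\<Sum>i\<in>UNIV. frame_dir i (H i) p + (if i = 4 then 2 * H i p else 0)) =
       ((\<Sum>i\<in>UNIV. \<Sum>a\<in>UNIV. C i a * u' i a + C' i a * u a) - 2 * (\<Sum>a\<in>UNIV. C 4 a * u a)) * density p"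
      by (simp add: sum_divide_distrib[symmetric] sum_subtractf)
    moreover have "(\<Sum>i\<in>UNIV. \<Sum>a\<in>UNIV. C i a * (u' i a + (\<Sum>b\<in>UNIV. conn_coeff i b a * u b)))
        + (\<Sum>a\<in>UNIV. u a * ((\<Sum>i\<in>UNIV. C' i a + (\<Sum>c\<in>UNIV. conn_coeff i c a * C i c)) - 2 * C 4 a))
      = (\<Sum>i\<in>UNIV. \<Sum>a\<in>UNIV. C i a * u' i a + C' i a * u a) - 2 * (\<Sum>a\<in>UNIV. C 4 a * u a)"
    proof -
      \<comment> \<open>Skewness in the last two indices moves the connection matrix from
        \<open>v\<close> onto the covariant derivative of \<open>y\<close>, so the terms without
        derivatives of \<open>v\<close> cancel.\<close>
      have 1: "(\<Sum>a\<in>UNIV. \<Sum>b\<in>UNIV. C i a * (conn_coeff i b a * u b))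
          = - (\<Sum>a\<in>UNIV. \<Sum>c\<in>UNIV. u a * (conn_coeff i c a * C i c))" for i
        by (subst sum.swap, subst conn_coeff_skew) (simp add: sum_negf mult_ac)
      have 2: "(\<Sum>a\<in>UNIV. u a * (\<Sum>i\<in>UNIV. C' i a + (\<Sum>c\<in>UNIV. conn_coeff i c a * C i c)))
        = (\<Sum>i\<in>UNIV. \<Sum>a\<in>UNIV. u a * C' i a) + (\<Sum>i\<in>UNIV. \<Sum>a\<in>UNIV. \<Sum>c\<in>UNIV. u a * (conn_coeff i c a * C i c))"
        unfolding sum_distrib_left by (subst sum.swap) (simp add: sum.distrib distrib_left sum_distrib_left)
      have 3: "(\<Sum>i\<in>UNIV. \<Sum>a\<in>UNIV. C i a * (u' i a + (\<Sum>b\<in>UNIV. conn_coeff i b a * u b)))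
        = (\<Sum>i\<in>UNIV. \<Sum>a\<in>UNIV. C i a * u' i a) - (\<Sum>i\<in>UNIV. \<Sum>a\<in>UNIV. \<Sum>c\<in>UNIV. u a * (conn_coeff i c a * C i c))"
        unfolding distrib_left sum.distrib sum_distrib_left 1 sum_negf by simp
      have 4: "(\<Sum>a\<in>UNIV. u a * ((\<Sum>i\<in>UNIV. C' i a + (\<Sum>c\<in>UNIV. conn_coeff i c a * C i c)) - 2 * C 4 a))
        = (\<Sum>a\<in>UNIV. u a * (\<Sum>i\<in>UNIV. C' i a + (\<Sum>c\<in>UNIV. conn_coeff i c a * C i c))) - 2 * (\<Sum>a\<in>UNIV. C 4 a * u a)"
        by (simp add: right_diff_distrib sum_subtractf sum_distrib_left mult_ac)
      show ?thesis
        unfolding 3 4 2 by (simp add: sum.distrib mult_ac)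
    qed
    moreover have "?f p + ?g p =
        ((\<Sum>i\<in>UNIV. \<Sum>a\<in>UNIV. C i a * (u' i a + (\<Sum>b\<in>UNIV. conn_coeff i b a * u b)))
        + (\<Sum>a\<in>UNIV. u a * ((\<Sum>i\<in>UNIV. C' i a + (\<Sum>c\<in>UNIV. conn_coeff i c a * C i c)) - 2 * C 4 a))) * density p"
      unfolding cov_coeff_def[of _ v] rough_laplacian_coeff_def C_def C'_def u_def u'_def
      by (rule distrib_right[symmetric])
    ultimately show ?thesis by (simp only:)
  qed
  \<comment> \<open>The integral of a non-integrable function is 0 by convention, so additivity has
    to be backed by integrability of both summands.\<close>
  have intf: "set_integrable lborel D ?f"
  proof (rule set_integrable_compact[OF D Ck_on_continuous[of 0]])
    have Av: "Ck_on 0 F4 (cov_coeff i v a)" for i a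
      by (rule Ck_on_cov_coeff) (use v in \<open>simp only: One_nat_def\<close>)
    show "Ck_on 0 F4 ?f"
      by (intro Ck_on_mult Ck_on_sum open_F4 Ck_on_density Av Ck_on_Suc_imp[OF A[unfolded One_nat_def]])
  qed
  have intg: "set_integrable lborel D ?g"
  proof (rule set_integrable_compact[OF D Ck_on_continuous[of 0]])
    show "Ck_on 0 F4 ?g"
      unfolding rough_laplacian_coeff_def
      by (intro Ck_on_mult Ck_on_sum Ck_on_add Ck_on_diff open_F4 Ck_on_density Ck_on_const
          Ck_on_frame_dir[OF A[unfolded One_nat_def]] Ck_on_Suc_imp[OF A[unfolded One_nat_def]]
          Ck_on_Suc_imp[OF v[unfolded One_nat_def]])
  qed
  have "set_lebesgue_integral lborel D ?f + set_lebesgue_integral lborel D ?g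
    = set_lebesgue_integral lborel D (\<lambda>p. ?f p + ?g p)"
    using set_integral_add[OF intf intg] by simp
  also have "\<dots> = set_lebesgue_integral lborel D
      (\<lambda>p. \<Sum>i\<in>UNIV. frame_dir i (H i) p + (if i = 4 then 2 * H i p else 0))"
    by (rule set_lebesgue_integral_cong) (use D eq in \<open>auto dest: compact_imp_closed\<close>)
  also have "\<dots> = 0"
  proof (rule set_integral_sum_eq_0)
    fix i :: 4
    have "continuous_on F4 (\<lambda>p. frame_dir i (H i) p + (if i = 4 then 2 * H i p else 0))"
      using Ck_on_continuous[OF CkH[of i]] Ck_on_continuous[OF Ck_on_frame_dir[OF CkH[of i, unfolded One_nat_def]]]
      by (cases "i = 4") (auto intro!: continuous_intros)
    then show "set_integrable lborel D (\<lambda>p. frame_dir i (H i) p + (if i = 4 then 2 * H i p else 0))"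
      by (rule set_integrable_compact[OF D])
    show "set_lebesgue_integral lborel D (\<lambda>p. frame_dir i (H i) p + (if i = 4 then 2 * H i p else 0)) = 0"
      by (rule set_integral_frame_divergence[OF D CkH H0])
  qed
  finally show ?thesis by simp
qed

text \<open>Polarization makes the energy exactly a quadratic polynomial in
  \<open>\<epsilon>\<close>, so the derivative at 0 is its linear coefficient and no differentiation
  under the integral sign occurs.\<close>

lemma vertical_energy_has_derivative:
  assumes D: "compact D" "D \<subseteq> F4" and X: "Ck_on 1 F4 X" and V: "Ck_on 1 F4 V"
  shows "((\<lambda>\<epsilon>. vertical_energy (\<lambda>p. X p + \<epsilon> *\<^sub>R V p) D) has_real_derivative
    set_lebesgue_integral lborel D (\<lambda>p. (\<Sum>i\<in>UNIV. \<Sum>a\<in>UNIV.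
      cov_coeff i (frame_coeff X) a p * cov_coeff i (frame_coeff V) a p) * density p)) (at 0)"
proof -
  define q where "q Y Z p = (\<Sum>i\<in>UNIV. \<Sum>a\<in>UNIV.
      cov_coeff i (frame_coeff Y) a p * cov_coeff i (frame_coeff Z) a p) * density p" for Y Z p
  define Q where "Q Y Z = set_lebesgue_integral lborel D (q Y Z)" for Y Z
  have int: "set_integrable lborel D (q Y Z)" if "Ck_on 1 F4 Y" "Ck_on 1 F4 Z" for Y Z
  proof (rule set_integrable_compact[OF D Ck_on_continuous[of 0]])
    show "Ck_on 0 F4 (q Y Z)"
      unfolding q_def
      by (intro Ck_on_mult Ck_on_sum open_F4 Ck_on_density Ck_on_cov_coeff Ck_on_frame_coeff
          that[unfolded One_nat_def])
  qed
  have "vertical_energy (\<lambda>p. X p + \<epsilon> *\<^sub>R V p) D = 1/2 * (Q X X + 2 * \<epsilon> * Q X V + \<epsilon>\<^sup>2 * Q V V)" for \<epsilon>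
  proof -
    have "norm_nabla_sq (\<lambda>p. X p + \<epsilon> *\<^sub>R V p) p * volume_density metric_F4 p
        = q X X p + (2 * \<epsilon>) * q X V p + \<epsilon>\<^sup>2 * q V V p" if p: "p \<in> F4" for p
    proof -
      have dX: "X differentiable (at p)" and dV: "V differentiable (at p)"
        using X V p by simp_all
      have coeffs: "frame_coeff (\<lambda>p. X p + \<epsilon> *\<^sub>R V p) =
          (\<lambda>a p. frame_coeff X a p + \<epsilon> * frame_coeff V a p)"
        by (rule ext) (rule frame_coeff_linear)
      have "norm_nabla_sq (\<lambda>p. X p + \<epsilon> *\<^sub>R V p) p = (\<Sum>i\<in>UNIV. \<Sum>a\<in>UNIV.
          (cov_coeff i (frame_coeff X) a p + \<epsilon> * cov_coeff i (frame_coeff V) a p)\<^sup>2)"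
        using dX dV
        by (simp add: norm_nabla_sq_eq[OF p] coeffs cov_coeff_linear
            frame_coeff_differentiable[OF p])
      then show ?thesis
        by (simp add: volume_density_F4[OF p] q_def power2_eq_square algebra_simps sum.distrib
            sum_distrib_left add_divide_distrib sum_divide_distrib)
    qed
    then have "vertical_energy (\<lambda>p. X p + \<epsilon> *\<^sub>R V p) D
        = 1/2 * set_lebesgue_integral lborel D (\<lambda>p. q X X p + (2 * \<epsilon>) * q X V p + \<epsilon>\<^sup>2 * q V V p)"
      unfolding vertical_energy_def
      by (intro arg_cong[of _ _ "\<lambda>x. 1/2 * x"] set_lebesgue_integral_cong)
        (use D in \<open>auto dest: compact_imp_closed\<close>)
    then show ?thesis
      using int[OF X X] int[OF X V] int[OF V V] by (simp add: Q_def set_integral_add)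
  qed
  moreover have "((\<lambda>\<epsilon>. 1/2 * (Q X X + 2 * \<epsilon> * Q X V + \<epsilon>\<^sup>2 * Q V V)) has_real_derivative Q X V) (at 0)"
    by (auto intro!: derivative_eq_intros)
  ultimately have "((\<lambda>\<epsilon>. vertical_energy (\<lambda>p. X p + \<epsilon> *\<^sub>R V p) D) has_real_derivative Q X V) (at 0)"
    by (simp only:)
  then show ?thesis unfolding Q_def q_def .
qed

section \<open>The Euler-Lagrange equation in frame components\<close>

lemma Ck_on_scaleR_frame:
  assumes "Ck_on k F4 \<phi>"
  shows "Ck_on k F4 (\<lambda>p. \<phi> p *\<^sub>R frame i p)"
proof (rule Ck_on_cong[OF open_F4])
  show "Ck_on k F4 (\<lambda>p. \<Sum>j\<in>UNIV. (\<phi> p * frame i p $ j) *\<^sub>R coord j)"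
    by (intro Ck_on_sum Ck_on_bounded_linear[OF open_F4 bounded_linear_scaleR_left] Ck_on_mult open_F4
        Ck_on_frame_nth assms)
  show "(\<Sum>j\<in>UNIV. (\<phi> p * frame i p $ j) *\<^sub>R coord j) = \<phi> p *\<^sub>R frame i p" for p
    by (simp add: vec_eq_iff coord_nth if_distrib cong: if_cong)
qed

theorem harmonic_section_iff_rough_laplacian:
  assumes X: "smooth_on F4 X"
  shows "harmonic_section X \<longleftrightarrow> (\<forall>p\<in>F4. \<forall>a. rough_laplacian_coeff (frame_coeff X) a p = 0)"
proof -
  have CX: "Ck_on k F4 X" for k using X by (simp add: smooth_on_def)
  let ?L = "rough_laplacian_coeff (frame_coeff X)"
  have first_variation: "((\<lambda>\<epsilon>. vertical_energy (\<lambda>p. X p + \<epsilon> *\<^sub>R V p) D) has_real_derivative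
      - set_lebesgue_integral lborel D (\<lambda>p. (\<Sum>a\<in>UNIV. frame_coeff V a p * ?L a p) * density p)) (at 0)"
    if "compact D" "D \<subseteq> F4" "smooth_on F4 V" "\<forall>p\<in>F4 - D. V p = 0" for D V
  proof -
    have CV: "Ck_on k F4 V" for k using that by (simp add: smooth_on_def)
    have "frame_coeff V a p = 0" if "p \<in> F4 - D" for a p
      using that \<open>\<forall>p\<in>F4 - D. V p = 0\<close> by (simp add: frame_coeff_def metric_ex_def)
    then show ?thesis
      using vertical_energy_has_derivative[OF that(1,2) CX CV]
        set_integral_green[OF that(1,2) Ck_on_frame_coeff[OF CX] Ck_on_frame_coeff[OF CV]] by simp
  qed
  show ?thesis
  proof
    assume R: "\<forall>p\<in>F4. \<forall>a. ?L a p = 0"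
    have "((\<lambda>\<epsilon>. vertical_energy (\<lambda>p. X p + \<epsilon> *\<^sub>R V p) D) has_real_derivative 0) (at 0)"
      if "compact D" "D \<subseteq> F4" "smooth_on F4 V" "\<forall>p\<in>F4 - D. V p = 0" for D V
    proof -
      have "set_lebesgue_integral lborel D (\<lambda>p. (\<Sum>a\<in>UNIV. frame_coeff V a p * ?L a p) * density p)
        = set_lebesgue_integral lborel D (\<lambda>p. 0)"
        by (rule set_lebesgue_integral_cong)
          (use that R in \<open>auto dest: compact_imp_closed intro!: sum.neutral\<close>)
      then show ?thesis using first_variation[OF that] by (simp add: set_lebesgue_integral_def)
    qed
    then show "harmonic_section X" using X unfolding harmonic_section_def by blast
  next
    assume harm: "harmonic_section X"
    show "\<forall>p\<in>F4. \<forall>a. ?L a p = 0"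
    proof (intro ballI allI)
      fix c a assume c: "c \<in> F4"
      \<comment> \<open>The density stays attached to the tested function because the fundamental
        lemma uses Lebesgue measure; being positive it is divided out at the end.\<close>
      have "?L a c * density c = 0"
      proof (rule fundamental_lemma_calculus_of_variations[OF open_F4 _ _ c])
        have "Ck_on 0 F4 (\<lambda>p. ?L a p * density p)"
          unfolding rough_laplacian_coeff_def
          by (intro Ck_on_mult Ck_on_sum Ck_on_add Ck_on_diff open_F4 Ck_on_density Ck_on_const
              Ck_on_frame_dir Ck_on_cov_coeff Ck_on_frame_coeff CX)
        then show "continuous_on F4 (\<lambda>p. ?L a p * density p)" by simp
        fix D and \<phi> :: "real^4 \<Rightarrow> real"
        assume D: "compact D" "D \<subseteq> F4" and \<phi>: "smooth_on F4 \<phi>" "\<And>p. p \<in> F4 - D \<Longrightarrow> \<phi> p = 0"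
        \<comment> \<open>By orthonormality the only nonzero frame component of this variation is
          \<open>\<phi>\<close>, in position \<open>a\<close>, which isolates one component of the
          rough Laplacian.\<close>
        define V where "V p = \<phi> p *\<^sub>R frame a p" for p
        have V: "smooth_on F4 V" "\<forall>p\<in>F4 - D. V p = 0"
          using \<phi> Ck_on_scaleR_frame[of _ \<phi> a] by (auto simp: smooth_on_def V_def[abs_def])
        have "set_lebesgue_integral lborel D (\<lambda>p. (\<Sum>b\<in>UNIV. frame_coeff V b p * ?L b p) * density p) = 0"
          using DERIV_unique[OF first_variation[OF D V]] harm D V
          unfolding harmonic_section_def by fastforce
        moreover have "(\<Sum>b\<in>UNIV. frame_coeff V b p * ?L b p) = \<phi> p * ?L a p" if "p \<in> F4" for p
          using that
          by (simp add: frame_coeff_def V_def bilinear_lmul[OF bilinear_metric_ex]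
              metric_ex_orthonormal if_distrib[of "\<lambda>x. x * _"] if_distrib[of "\<lambda>x. _ * x"] cong: if_cong)
        then have "set_lebesgue_integral lborel D (\<lambda>p. (\<Sum>b\<in>UNIV. frame_coeff V b p * ?L b p) * density p)
            = set_lebesgue_integral lborel D (\<lambda>p. \<phi> p * (?L a p * density p))"
          by (intro set_lebesgue_integral_cong) (use D in \<open>auto dest: compact_imp_closed\<close>)
        ultimately show "set_lebesgue_integral lborel D (\<lambda>p. \<phi> p * (?L a p * density p)) = 0" by simp
      qed
      then show "?L a c = 0" using c by (simp add: F4_def)
    qed
  qed
qed

section \<open>Vector fields depending only on s and t\<close>

text \<open>The functions of (s, t) inherit their differentiability from the lift \<open>F\<close>:
  it is restricted to coordinate lines, which stay in \<open>F4\<close> for an open set of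
  parameters, and compared with the one-variable derivatives.\<close>

lemma frechet_derivative_lift_st:
  assumes p: "p \<in> F4" and F: "F differentiable (at p)"
    and eq: "\<forall>q\<in>F4. F q = f (q $ 3) (q $ 4)"
  shows "frechet_derivative F (at p) (coord j) =
    (if j = 3 then partial_s f (p $ 3) (p $ 4) else if j = 4 then partial_t f (p $ 3) (p $ 4) else 0)"
proof -
  let ?F' = "frechet_derivative F (at p)"
  have line: "((\<lambda>u. f ((p + u *\<^sub>R coord j) $ 3) ((p + u *\<^sub>R coord j) $ 4)) has_real_derivative
      ?F' (coord j)) (at 0)" for j
  proof -
    have F': "(F has_derivative ?F') (at (p + 0 *\<^sub>R coord j))"
      using F by (simp add: frechet_derivative_works)
    have "((\<lambda>u. p + u *\<^sub>R coord j) has_derivative (\<lambda>u. u *\<^sub>R coord j)) (at 0)"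
      by (auto intro!: derivative_eq_intros)
    from has_derivative_compose[OF this F']
    have "((\<lambda>u. F (p + u *\<^sub>R coord j)) has_derivative (\<lambda>u. ?F' (u *\<^sub>R coord j))) (at 0)" .
    moreover have "(\<lambda>u. ?F' (u *\<^sub>R coord j)) = (*) (?F' (coord j))"
      by (rule ext) (simp add: linear_cmul[OF linear_frechet_derivative[OF F]] mult.commute)
    ultimately have "((\<lambda>u. F (p + u *\<^sub>R coord j)) has_real_derivative ?F' (coord j)) (at 0)"
      by (simp add: has_field_derivative_def)
    moreover have "open ((\<lambda>u. p + u *\<^sub>R coord j) -` F4)"
      by (intro open_vimage open_F4 continuous_intros)
    ultimately show ?thesis
      by (rule has_field_derivative_transform_within_open) (use p eq in auto)
  qed
  have "\<forall>j. ?F' (coord j) = (if j = 3 then partial_s f (p $ 3) (p $ 4)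
      else if j = 4 then partial_t f (p $ 3) (p $ 4) else 0)"
    unfolding forall_4
  proof (intro conjI)
    have const: "?F' (coord j) = 0" if "j = 1 \<or> j = 2" for j
    proof -
      have "((\<lambda>u. f (p $ 3) (p $ 4)) has_real_derivative ?F' (coord j)) (at 0)"
        using line[of j] that by (auto simp: coord_nth)
      then show ?thesis using DERIV_unique DERIV_const by blast
    qed
    show "?F' (coord 1) = (if (1::4) = 3 then partial_s f (p $ 3) (p $ 4)
      else if (1::4) = 4 then partial_t f (p $ 3) (p $ 4) else 0)"
      using const[of 1] by simp
    show "?F' (coord 2) = (if (2::4) = 3 then partial_s f (p $ 3) (p $ 4)
      else if (2::4) = 4 then partial_t f (p $ 3) (p $ 4) else 0)"
      using const[of 2] by simp
    have "((\<lambda>u. f (u + p $ 3) (p $ 4)) has_real_derivative ?F' (coord 3)) (at 0)"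
      using line[of 3] by (simp add: coord_nth add.commute)
    then have "((\<lambda>u. f u (p $ 4)) has_real_derivative ?F' (coord 3)) (at (0 + p $ 3))"
      by (simp only: DERIV_shift)
    then show "?F' (coord 3) = (if (3::4) = 3 then partial_s f (p $ 3) (p $ 4)
      else if (3::4) = 4 then partial_t f (p $ 3) (p $ 4) else 0)"
      by (simp add: partial_s_def DERIV_imp_deriv)
    have "((\<lambda>u. f (p $ 3) (u + p $ 4)) has_real_derivative ?F' (coord 4)) (at 0)"
      using line[of 4] by (simp add: coord_nth add.commute)
    then have "((\<lambda>u. f (p $ 3) u) has_real_derivative ?F' (coord 4)) (at (0 + p $ 4))"
      by (simp only: DERIV_shift)
    then show "?F' (coord 4) = (if (4::4) = 3 then partial_s f (p $ 3) (p $ 4)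
      else if (4::4) = 4 then partial_t f (p $ 3) (p $ 4) else 0)"
      by (simp add: partial_t_def DERIV_imp_deriv)
  qed
  then show ?thesis by blast
qed

lemma frame_dir_lift_st:
  assumes p: "p \<in> F4" and F: "F differentiable (at p)"
    and eq: "\<forall>q\<in>F4. F q = f (q $ 3) (q $ 4)"
  shows "frame_dir i F p = (if i = 3 then 2 * p $ 4 * partial_s f (p $ 3) (p $ 4)
    else if i = 4 then 2 * p $ 4 * partial_t f (p $ 3) (p $ 4) else 0)"
proof -
  have "frame_dir i F p = (\<Sum>k\<in>UNIV. frame i p $ k * frechet_derivative F (at p) (coord k))" for i
    unfolding frame_dir_def by (rule linear_expand_coord[OF linear_frechet_derivative[OF F]])
  then have "\<forall>i. frame_dir i F p = (if i = 3 then 2 * p $ 4 * partial_s f (p $ 3) (p $ 4)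
    else if i = 4 then 2 * p $ 4 * partial_t f (p $ 3) (p $ 4) else 0)"
    unfolding forall_4 frechet_derivative_lift_st[where F = F and f = f, OF p F eq] sum_4
    by (simp add: frame_simps coord_nth)
  then show ?thesis by blast
qed

text \<open>Makes the partial derivatives themselves differentiable lifts, so that the rule for
  \<open>frame_dir\<close> can be applied a second time.\<close>

lemma Ck_on_partial_lift_st:
  assumes F: "Ck_on (Suc k) F4 F" and eq: "\<forall>q\<in>F4. F q = f (q $ 3) (q $ 4)"
  shows "Ck_on k F4 (\<lambda>q. partial_s f (q $ 3) (q $ 4))" "Ck_on k F4 (\<lambda>q. partial_t f (q $ 3) (q $ 4))"
proof -
  have "frechet_derivative F (at q) (coord j) =
    (if j = 3 then partial_s f (q $ 3) (q $ 4) else if j = 4 then partial_t f (q $ 3) (q $ 4) else 0)"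
    if "q \<in> F4" for q j
    by (rule frechet_derivative_lift_st[where f = f, OF that]) (use F eq that in auto)
  from this[of _ 3] this[of _ 4]
  show "Ck_on k F4 (\<lambda>q. partial_s f (q $ 3) (q $ 4))" "Ck_on k F4 (\<lambda>q. partial_t f (q $ 3) (q $ 4))"
    using Ck_on_cong[OF open_F4 _ Ck_on_SucD(2)[OF F, of "coord 3"]]
      Ck_on_cong[OF open_F4 _ Ck_on_SucD(2)[OF F, of "coord 4"]] by simp_all
qed

text \<open>The first-order t-terms cancel: differentiating the factor 2t along e_4 yields 4t x_t,
  and the trace term removes it. The s-terms occur twice, once when the outer derivative meets the
  connection term and once in the opposite order, which accounts for the factor 4t.\<close>

lemma rough_laplacian_coeff_lift_st:
  assumes p: "p \<in> F4" and y: "\<And>a. Ck_on 2 F4 (y a)"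
    and eq: "\<And>a. \<forall>q\<in>F4. y a q = x a (q $ 3) (q $ 4)"
  defines "s \<equiv> p $ 3" and "t \<equiv> p $ 4"
  shows "rough_laplacian_coeff y a p =
    4 * t\<^sup>2 * (partial_t (partial_t (x a)) s t + partial_s (partial_s (x a)) s t)
    + 4 * t * (\<Sum>b\<in>UNIV. conn_coeff 3 b a * partial_s (x b) s t)
    + (\<Sum>i\<in>UNIV. \<Sum>c\<in>UNIV. conn_coeff i c a * (\<Sum>b\<in>UNIV. conn_coeff i b c * x b s t))"
proof -
  have y2: "Ck_on (Suc (Suc 0)) F4 (y a)" for a
    using y[of a] by (simp only: numeral_2_eq_2)
  have dy: "y a differentiable (at q)" if "q \<in> F4" for a q
    using y2[of a] that by simp
  have d1: "frame_dir i (y a) q = (if i = 3 then 2 * q $ 4 * partial_s (x a) (q $ 3) (q $ 4)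
      else if i = 4 then 2 * q $ 4 * partial_t (x a) (q $ 3) (q $ 4) else 0)" if "q \<in> F4" for i a q
    by (rule frame_dir_lift_st[OF that dy[OF that] eq])
  let ?xs = "\<lambda>a q. partial_s (x a) (q $ 3) (q $ 4)"
  let ?xt = "\<lambda>a q. partial_t (x a) (q $ 3) (q $ 4)"
  have dxs: "?xs a differentiable (at q)" and dxt: "?xt a differentiable (at q)" if "q \<in> F4" for a q
    using Ck_on_partial_lift_st[OF y2 eq, of a] that by simp_all
  have dt: "(\<lambda>q. 2 * q $ 4) differentiable (at p)"
    by (intro differentiable_mult differentiable_const bounded_linear_imp_differentiable[OF bounded_linear_vec_nth])
  have dir_t: "frame_dir i (\<lambda>q. 2 * q $ 4) p = (if i = 4 then 4 * t else 0)" for i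
  proof -
    have "((\<lambda>q::real^4. 2 * q $ 4) has_derivative (\<lambda>v. 2 * v $ 4)) (at p)"
      by (intro has_derivative_mult_right bounded_linear_imp_has_derivative bounded_linear_vec_nth)
    from frechet_derivative_at[OF this, symmetric]
    have "frame_dir i (\<lambda>q. 2 * q $ 4) p = 2 * frame i p $ 4" for i
      by (simp add: frame_dir_def)
    then have "\<forall>i. frame_dir i (\<lambda>q. 2 * q $ 4) p = (if i = 4 then 4 * t else 0)"
      unfolding forall_4 by (simp add: frame_simps coord_nth t_def)
    then show ?thesis by blast
  qed
  have cov: "cov_coeff i y a q = (if i = 3 then 2 * q $ 4 * ?xs a q else if i = 4 then 2 * q $ 4 * ?xt a q else 0)
      + (\<Sum>b\<in>UNIV. conn_coeff i b a * y b q)" if "q \<in> F4" for i a q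
    unfolding cov_coeff_def d1[OF that] by simp
  \<comment> \<open>An explicit expression agreeing with \<open>cov_coeff\<close> on
    \<open>F4\<close>; as \<open>F4\<close> is open, the two have equal derivatives there.\<close>
  define z where "z i a q = (if i = 3 then 2 * q $ 4 * ?xs a q else if i = 4 then 2 * q $ 4 * ?xt a q else 0)
      + (\<Sum>b\<in>UNIV. conn_coeff i b a * y b q)" for i a q
  have dcov: "cov_coeff i y a differentiable (at p)" for i a
    using Ck_on_cov_coeff[OF y2, where i = i and a = a] p by simp
  have dlin: "(\<lambda>q. \<Sum>b\<in>UNIV. conn_coeff i b a * y b q) differentiable (at p)" for i a
    by (intro differentiable_sum ballI differentiable_mult differentiable_const dy p finite)
  have dirlin: "frame_dir i (\<lambda>q. \<Sum>b\<in>UNIV. conn_coeff i b a * y b q) p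
      = (\<Sum>b\<in>UNIV. conn_coeff i b a * frame_dir i (y b) p)" for i a
    by (subst frame_dir_sum) (auto simp: frame_dir_mult frame_dir_const differentiable_mult dy p)
  have "frame_dir i (cov_coeff i y a) p = frame_dir i (z i a) p" for i a
    by (rule frame_dir_cong[OF p _ dcov]) (simp add: cov z_def)
  moreover have "frame_dir i (z i a) p =
      (if i = 3 then 4 * t\<^sup>2 * partial_s (partial_s (x a)) s t + 2 * t * (\<Sum>b\<in>UNIV. conn_coeff 3 b a * partial_s (x b) s t)
       else if i = 4 then 4 * t\<^sup>2 * partial_t (partial_t (x a)) s t + 4 * t * partial_t (x a) s t else 0)" for i a
  proof -
    \<comment> \<open>The frame is parallel along e_4.\<close>
    have k4: "conn_coeff 4 b c = 0" for b c
      by (simp add: conn_coeff_def)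
    have "frame_dir i (z i a) p =
      (if i = 3 then frame_dir i (\<lambda>q. 2 * q $ 4 * ?xs a q) p else if i = 4 then frame_dir i (\<lambda>q. 2 * q $ 4 * ?xt a q) p else 0)
      + (\<Sum>b\<in>UNIV. conn_coeff i b a * frame_dir i (y b) p)"
      unfolding z_def dirlin[symmetric]
      by (cases "i = 3"; cases "i = 4")
        (simp_all add: frame_dir_add[OF differentiable_mult[OF dt dxs[OF p]] dlin]
          frame_dir_add[OF differentiable_mult[OF dt dxt[OF p]] dlin])
    also have "\<dots> =
      (if i = 3 then 4 * t\<^sup>2 * partial_s (partial_s (x a)) s t + 2 * t * (\<Sum>b\<in>UNIV. conn_coeff 3 b a * partial_s (x b) s t)
       else if i = 4 then 4 * t\<^sup>2 * partial_t (partial_t (x a)) s t + 4 * t * partial_t (x a) s t else 0)"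
      unfolding frame_dir_mult[OF dt dxs[OF p]] frame_dir_mult[OF dt dxt[OF p]] dir_t
        frame_dir_lift_st[where F = "?xs a" and f = "partial_s (x a)" for a, OF p dxs[OF p] ballI[OF refl]]
        frame_dir_lift_st[where F = "?xt a" and f = "partial_t (x a)" for a, OF p dxt[OF p] ballI[OF refl]] d1[OF p]
      by (simp add: k4 s_def t_def power2_eq_square sum_distrib_left mult_ac)
    finally show ?thesis .
  qed
  ultimately have second: "(\<Sum>i\<in>UNIV. frame_dir i (cov_coeff i y a) p) =
      4 * t\<^sup>2 * (partial_t (partial_t (x a)) s t + partial_s (partial_s (x a)) s t)
      + 2 * t * (\<Sum>b\<in>UNIV. conn_coeff 3 b a * partial_s (x b) s t) + 4 * t * partial_t (x a) s t"
    by (simp add: sum_4 algebra_simps)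
  have k4: "conn_coeff 4 b c = 0" for b c
    by (simp add: conn_coeff_def)
  have first: "(\<Sum>i\<in>UNIV. \<Sum>c\<in>UNIV. conn_coeff i c a * cov_coeff i y c p)
    = 2 * t * (\<Sum>b\<in>UNIV. conn_coeff 3 b a * partial_s (x b) s t)
     + (\<Sum>i\<in>UNIV. \<Sum>c\<in>UNIV. conn_coeff i c a * (\<Sum>b\<in>UNIV. conn_coeff i b c * x b s t))"
    unfolding cov[OF p] bspec[OF eq p] s_def t_def distrib_left sum.distrib
    by (simp add: sum_4 k4 algebra_simps)
  show ?thesis
    unfolding rough_laplacian_coeff_def sum.distrib second first
    by (simp add: cov[OF p] k4 s_def t_def)
qed

theorem theorem4p1:
  fixes X :: "real^4 \<Rightarrow> real^4"
    and X1 X2 X3 X4 :: "real \<Rightarrow> real \<Rightarrow> real"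
  assumes "smooth_on F4 X"
    and "\<And>p. p \<in> F4 \<Longrightarrow>
           X p = X1 (p$3) (p$4) *\<^sub>R frame 1 p + X2 (p$3) (p$4) *\<^sub>R frame 2 p
               + X3 (p$3) (p$4) *\<^sub>R frame 3 p + X4 (p$3) (p$4) *\<^sub>R frame 4 p"
  shows "harmonic_section X \<longleftrightarrow>
    (\<forall>s t. t > 0 \<longrightarrow>
       4 * t\<^sup>2 * partial_t (partial_t X1) s t + 4 * t\<^sup>2 * partial_s (partial_s X1) s t
         + 4 * t * partial_s X2 s t - 3 * X1 s t = 0 \<and>
       4 * t\<^sup>2 * partial_t (partial_t X2) s t + 4 * t\<^sup>2 * partial_s (partial_s X2) s t
         - 4 * t * partial_s X1 s t - 3 * X2 s t = 0 \<and>
       2 * t\<^sup>2 * partial_t (partial_t X3) s t + 2 * t\<^sup>2 * partial_s (partial_s X3) s t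
         - 4 * t * partial_s X4 s t - 3 * X3 s t = 0 \<and>
       2 * t\<^sup>2 * partial_t (partial_t X4) s t + 2 * t\<^sup>2 * partial_s (partial_s X4) s t
         + 4 * t * partial_s X3 s t - 3 * X4 s t = 0)"
proof -
  define x where "x a = (if a = 1 then X1 else if a = 2 then X2 else if a = 3 then X3 else X4)" for a :: 4
  have x: "x 1 = X1" "x 2 = X2" "x 3 = X3" "x 4 = X4"
    by (simp_all add: x_def)
  have coeff: "\<forall>q\<in>F4. frame_coeff X a q = x a (q $ 3) (q $ 4)" for a
  proof
    fix q assume q: "q \<in> F4"
    have "X q = (\<Sum>b\<in>UNIV. x b (q $ 3) (q $ 4) *\<^sub>R frame b q)"
      using assms(2)[OF q] by (simp add: sum_4 x)
    then show "frame_coeff X a q = x a (q $ 3) (q $ 4)"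
      using bilinear_metric_ex[of q]
      by (simp add: frame_coeff_def bilinear_def linear_sum[of "\<lambda>u. metric_ex q u _"]
          linear_cmul[of "\<lambda>u. metric_ex q u _"] metric_ex_orthonormal[OF q] if_distrib cong: if_cong)
  qed
  have "Ck_on 2 F4 (frame_coeff X a)" for a
    using assms(1) by (intro Ck_on_frame_coeff) (simp add: smooth_on_def)
  note lap = rough_laplacian_coeff_lift_st[where y = "frame_coeff X" and x = x, OF _ this coeff]
  define P where "P s t \<longleftrightarrow>
       4 * t\<^sup>2 * partial_t (partial_t X1) s t + 4 * t\<^sup>2 * partial_s (partial_s X1) s t
         + 4 * t * partial_s X2 s t - 3 * X1 s t = 0 \<and>
       4 * t\<^sup>2 * partial_t (partial_t X2) s t + 4 * t\<^sup>2 * partial_s (partial_s X2) s t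
         - 4 * t * partial_s X1 s t - 3 * X2 s t = 0 \<and>
       2 * t\<^sup>2 * partial_t (partial_t X3) s t + 2 * t\<^sup>2 * partial_s (partial_s X3) s t
         - 4 * t * partial_s X4 s t - 3 * X3 s t = 0 \<and>
       2 * t\<^sup>2 * partial_t (partial_t X4) s t + 2 * t\<^sup>2 * partial_s (partial_s X4) s t
         + 4 * t * partial_s X3 s t - 3 * X4 s t = 0" for s t
  \<comment> \<open>Each nonzero connection matrix rotates two disjoint pairs of indices, so its
    square is diagonal. The zeroth-order coefficients -3, -3, -6, -6 are minus the sums of squared
    rotation speeds.\<close>
  have "(\<forall>a. rough_laplacian_coeff (frame_coeff X) a p = 0) \<longleftrightarrow> P (p $ 3) (p $ 4)" if "p \<in> F4" for p
    unfolding lap[OF that] forall_4 sum_4 P_def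
    by (auto simp: conn_coeff_def x algebra_simps)
  then have "harmonic_section X \<longleftrightarrow> (\<forall>p\<in>F4. P (p $ 3) (p $ 4))"
    using harmonic_section_iff_rough_laplacian[OF assms(1)] by simp
  also have "\<dots> \<longleftrightarrow> (\<forall>s t. t > 0 \<longrightarrow> P s t)"
  proof -
    \<comment> \<open>The point over (s, t) is taken with x = y = 0.\<close>
    have "\<exists>p\<in>F4. p $ 3 = s \<and> p $ 4 = t" if "t > 0" for s t
      using that by (intro bexI[of _ "s *\<^sub>R coord 3 + t *\<^sub>R coord 4"]) (simp_all add: F4_def coord_nth)
    moreover have "p $ 4 > 0" if "p \<in> F4" for p
      using that by (simp add: F4_def)
    ultimately show ?thesis by metis
  qed
  finally show ?thesis unfolding P_def .
qed

end
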